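(* Let $Q\ne0$ be real and let $V(z)=Q+aV_0(z)$, $V_0(z)\in\mathfrak M$, be a function of the class $\mathfrak N^Q$. Let $\Theta_0$ be a minimal L-system (with one-dimensional input-output space $\mathbb C$ and $J=1$) that realizes $V_0(z)$ and contains a symmetric operator $\dot A$ with deficiency vectors $g_z\in\mathrm{Ker}(\dot A^*-zI)$ and fixed normalized deficiency vectors $g_\pm=g_{\pm i}$. Then the perturbed function $V(z)$ admits a unique realization by an L-system $\Theta$ with the same symmetric operator $\dot A$ in the corresponding state space if the Livšic function $$s(z)=\frac{z-i}{z+i}\cdot\frac{(g_z,g_-)}{(g_z,g_+)}$$ of $\dot A$ is not identically zero in the upper half-plane.
   Context: Classes: $\mathfrak M$ is the set of functions $M(z)=\int_{\mathbb R}\left(\frac{1}{\lambda-z}-\frac{\lambda}{1+\lambda^2}\right)d\mu(\lambda)$ with $\mu$ an infinite Borel measure and $\int_{\mathbb R}\frac{d\mu}{1+\lambda^2}=1$; $\mathfrak N^Q$ is the set of functions $Q+\int_{\mathbb R}\left(\frac{1}{\lambda-z}-\frac{\lambda}{1+\lambda^2}\right)d\mu(\lambda)$ with $\mu$ an infinite Borel measure and $\int_{\mathbb R}\frac{d\mu}{1+\lambda^2}=a<\infty$ (so $a>0$). Rigged space: for a closed densely defined symmetric operator $\dot A$ with deficiency indices $(1,1)$ in a complex Hilbert space $\mathcal H$, let $\mathcal H_+=\mathrm{Dom}(\dot A^* )$ with $(f,g)_+=(f,g)+(\dot A^*f,\dot A^*g)$, and let $\mathcal H_+\subset\mathcal H\subset\mathcal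 H_-$ be the associated rigged Hilbert space (the state space). $[X,Y]$ denotes bounded linear operators. If $\mathbb A\in[\mathcal H_+,\mathcal H_-]$ then $\mathbb A^*\in[\mathcal H_+,\mathcal H_-]$; $\mathrm{Re}\,\mathbb A=(\mathbb A+\mathbb A^* )/2$, $\mathrm{Im}\,\mathbb A=(\mathbb A-\mathbb A^* )/2i$. The quasi-kernel $\hat A$ of $\mathrm{Re}\,\mathbb A$ is its restriction to $\{f\in\mathcal H_+:\mathrm{Re}\,\mathbb A f\in\mathcal H\}$. L-system: let $T$ be a non-symmetric operator with $\dot A\subset T\subset\dot A^*$, $\rho(T)\ne\emptyset$, $\mathrm{Dom}(\dot A)=\mathrm{Dom}(T)\cap\mathrm{Dom}(T^* )$. A $( * )$-extension of $T$ is $\mathbb A\in[\mathcal H_+,\mathcal H_-]$ with $\dot A\subset T\subset\mathbb A$, $\dot A\subset T^*\subset\mathbb A^*$ such that the quasi-kernel $\hat A$ of $\mathrm{Re}\,\mathbb A$ is self-adjoint in $\mathcal H$. An L-system is $\Theta=\begin{pmatrix}\mathbb A&K&1\\ \mathcal H_+\subset\mathcal H\subset\mathcal H_-&&\mathbb C\end{pmatrix}$ where $\mathbb A$ is a $( * )$-extension of such a $T$ (main operator), $K\in[\mathbb C,\mathcal H_-]$, $\mathrm{Im}\,\mathbb A=KK^*$, $\mathrm{Ran}(K)=\mathrm{Ran}(\mathrm{Im}\,\mathbb A)$. It is minimal if $\dot A$ is prime (no nontrivial reducing subspace on which $\dot A$ induces a self-adjoint operator). Impedance function: $V_\Theta(z)=K^*(\mathrm{Re}\,\mathbb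 A-zI)^{-1}K$, $z\in\rho(\hat A)$. $\Theta$ realizes $V$ if $V=V_\Theta$ on $\mathbb C_\pm$. (In the paper, two L-systems over the same $\dot A$ are regarded as different when their main operators differ; multiplying $K$ by a unimodular constant does not change $\mathbb A$ or $V_\Theta$.) *)

theory Defs
  imports "HOL-Analysis.Analysis"
begin

section \<open>Complex Hilbert spaces\<close>

text \<open>The inner product is linear in the first and antilinear in the second argument. The real
  Hilbert space structure inherited from the superclasses is the underlying real one.\<close>

class complex_hilbert = real_inner + complete_space +
  fixes scaleC :: "complex \<Rightarrow> 'a \<Rightarrow> 'a"
    and cinner :: "'a \<Rightarrow> 'a \<Rightarrow> complex"
  assumes scaleC_add_right: "scaleC c (x + y) = scaleC c x + scaleC c y"
    and scaleC_add_left: "scaleC (c + d) x = scaleC c x + scaleC d x"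
    and scaleC_scaleC: "scaleC c (scaleC d x) = scaleC (c * d) x"
    and scaleC_of_real: "scaleC (complex_of_real r) x = r *\<^sub>R x"
    and cinner_add_left: "cinner (x + y) z = cinner x z + cinner y z"
    and cinner_scaleC_left: "cinner (scaleC c x) y = c * cinner x y"
    and cinner_commute: "cinner x y = cnj (cinner y x)"
    and Re_cinner: "Re (cinner x y) = x \<bullet> y"

interpretation complex_vector:
  vector_space "scaleC :: complex \<Rightarrow> 'a \<Rightarrow> 'a::complex_hilbert"
proof
  fix c d :: complex and x y :: 'a
  show "scaleC c (x + y) = scaleC c x + scaleC c y" by (rule scaleC_add_right)
  show "scaleC (c + d) x = scaleC c x + scaleC d x" by (rule scaleC_add_left)
  show "scaleC c (scaleC d x) = scaleC (c * d) x" by (rule scaleC_scaleC)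
  show "scaleC 1 x = x" using scaleC_of_real[of 1 x] by simp
qed

definition orth_compl :: "'h::complex_hilbert set \<Rightarrow> 'h set" where
  "orth_compl S = {v. \<forall>u\<in>S. cinner u v = 0}"


section \<open>Unbounded operators\<close>

text \<open>An operator is identified with its graph, so that extension of operators is inclusion.\<close>

type_synonym 'h graph = "('h \<times> 'h) set"

definition linear_operator :: "'h::complex_hilbert graph \<Rightarrow> bool" where
  "linear_operator T \<longleftrightarrow> single_valued T \<and> (0, 0) \<in> T
     \<and> (\<forall>(f, f')\<in>T. \<forall>(g, g')\<in>T. (f + g, f' + g') \<in> T)
     \<and> (\<forall>c. \<forall>(f, f')\<in>T. (scaleC c f, scaleC c f') \<in> T)"

definition apply_op :: "'h::complex_hilbert graph \<Rightarrow> 'h \<Rightarrow> 'h" where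
  "apply_op T f = (THE f'. (f, f') \<in> T)"

definition adjoint_in :: "'h::complex_hilbert set \<Rightarrow> 'h graph \<Rightarrow> 'h graph" where
  "adjoint_in S T = {(g, g') \<in> S \<times> S. \<forall>(f, f')\<in>T. cinner f' g = cinner f g'}"

abbreviation adjoint_op :: "'h::complex_hilbert graph \<Rightarrow> 'h graph" where
  "adjoint_op \<equiv> adjoint_in UNIV"

definition self_adjoint_in :: "'h::complex_hilbert set \<Rightarrow> 'h graph \<Rightarrow> bool" where
  "self_adjoint_in S T \<longleftrightarrow> linear_operator T \<and> T \<subseteq> S \<times> S \<and> S \<subseteq> closure (Domain T)
     \<and> adjoint_in S T = T"

definition symmetric_op :: "'h::complex_hilbert graph \<Rightarrow> bool" where
  "symmetric_op T \<longleftrightarrow> linear_operator T \<and> closure (Domain T) = UNIV \<and> T \<subseteq> adjoint_op T"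

definition resolvent_set :: "'h::complex_hilbert graph \<Rightarrow> complex set" where
  "resolvent_set T = {z.
     (\<forall>h. \<exists>!f. \<exists>f'. (f, f') \<in> T \<and> f' - scaleC z f = h)
     \<and> (\<exists>C. \<forall>(f, f')\<in>T. norm f \<le> C * norm (f' - scaleC z f))}"

definition deficiency_space :: "'h::complex_hilbert graph \<Rightarrow> complex \<Rightarrow> 'h set" where
  "deficiency_space A z = {g. (g, scaleC z g) \<in> adjoint_op A}"

definition deficiency_indices_1_1 :: "'h::complex_hilbert graph \<Rightarrow> bool" where
  "deficiency_indices_1_1 A \<longleftrightarrow>
     complex_vector.dim (deficiency_space A \<i>) = 1 \<and>
     complex_vector.dim (deficiency_space A (- \<i>)) = 1"

definition reduces :: "'h::complex_hilbert set \<Rightarrow> 'h graph \<Rightarrow> bool" where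
  "reduces S A \<longleftrightarrow> complex_vector.subspace S \<and> closed S \<and>
     (\<forall>(f, f')\<in>A. \<exists>(u, u') \<in> A \<inter> S \<times> S. \<exists>(v, v') \<in> A \<inter> orth_compl S \<times> orth_compl S.
        f = u + v \<and> f' = u' + v')"

definition prime_op :: "'h::complex_hilbert graph \<Rightarrow> bool" where
  "prime_op A \<longleftrightarrow> \<not> (\<exists>S. S \<noteq> {0} \<and> reduces S A \<and> self_adjoint_in S (A \<inter> S \<times> S))"

text \<open>Here \<open>g z\<close> is meant to span the deficiency space at \<open>z\<close>; the value does not depend on the
  choice of \<open>g z\<close> for \<open>z \<noteq> \<i>, - \<i>\<close>, and rescaling \<open>g \<i>\<close> and \<open>g (- \<i>)\<close> by unimodular
  constants multiplies it by a unimodular constant.\<close>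

definition livsic_function :: "(complex \<Rightarrow> 'h::complex_hilbert) \<Rightarrow> complex \<Rightarrow> complex" where
  "livsic_function g z =
     (z - \<i>) / (z + \<i>) * (cinner (g z) (g (- \<i>)) / cinner (g z) (g \<i>))"


section \<open>The rigged Hilbert space of a symmetric operator\<close>

definition H_plus :: "'h::complex_hilbert graph \<Rightarrow> 'h set" where
  "H_plus A = Domain (adjoint_op A)"

definition inner_plus :: "'h::complex_hilbert graph \<Rightarrow> 'h \<Rightarrow> 'h \<Rightarrow> complex" where
  "inner_plus A f g =
     cinner f g + cinner (apply_op (adjoint_op A) f) (apply_op (adjoint_op A) g)"

definition norm_plus :: "'h::complex_hilbert graph \<Rightarrow> 'h \<Rightarrow> real" where
  "norm_plus A f = sqrt (Re (inner_plus A f f))"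

text \<open>\<open>H_minus A\<close> consists of the bounded antilinear functionals on \<open>H_plus A\<close>; the value
  \<open>\<phi> f\<close> is the duality pairing \<open>(\<phi>, f)\<close>. Functionals on \<open>H_plus A\<close>, and below operators on
  \<open>H_plus A\<close>, are extended by zero, so that equality of HOL functions is equality on
  \<open>H_plus A\<close>.\<close>

definition H_minus :: "'h::complex_hilbert graph \<Rightarrow> ('h \<Rightarrow> complex) set" where
  "H_minus A = {\<phi>.
     (\<forall>f\<in>H_plus A. \<forall>g\<in>H_plus A. \<phi> (f + g) = \<phi> f + \<phi> g)
     \<and> (\<forall>c. \<forall>f\<in>H_plus A. \<phi> (scaleC c f) = cnj c * \<phi> f)
     \<and> (\<exists>C. \<forall>f\<in>H_plus A. cmod (\<phi> f) \<le> C * norm_plus A f)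
     \<and> (\<forall>f. f \<notin> H_plus A \<longrightarrow> \<phi> f = 0)}"

definition norm_minus :: "'h::complex_hilbert graph \<Rightarrow> ('h \<Rightarrow> complex) \<Rightarrow> real" where
  "norm_minus A \<phi> = Sup {cmod (\<phi> f) | f. f \<in> H_plus A \<and> norm_plus A f \<le> 1}"

definition emb :: "'h::complex_hilbert graph \<Rightarrow> 'h \<Rightarrow> 'h \<Rightarrow> complex" where
  "emb A h = (\<lambda>f. if f \<in> H_plus A then cinner h f else 0)"

definition ops_plus_minus ::
    "'h::complex_hilbert graph \<Rightarrow> ('h \<Rightarrow> 'h \<Rightarrow> complex) set" where
  "ops_plus_minus A = {B.
     (\<forall>f\<in>H_plus A. B f \<in> H_minus A)
     \<and> (\<forall>f\<in>H_plus A. \<forall>g\<in>H_plus A. B (f + g) = (\<lambda>h. B f h + B g h))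
     \<and> (\<forall>c. \<forall>f\<in>H_plus A. B (scaleC c f) = (\<lambda>h. c * B f h))
     \<and> (\<exists>C. \<forall>f\<in>H_plus A. norm_minus A (B f) \<le> C * norm_plus A f)
     \<and> (\<forall>f. f \<notin> H_plus A \<longrightarrow> B f = (\<lambda>_. 0))}"

text \<open>The adjoint in \<open>ops_plus_minus A\<close> is given by \<open>(B* f, g) = cnj (B g, f)\<close>.\<close>

definition adj_pm :: "('h \<Rightarrow> 'h \<Rightarrow> complex) \<Rightarrow> 'h \<Rightarrow> 'h \<Rightarrow> complex" where
  "adj_pm B = (\<lambda>f g. cnj (B g f))"

definition Re_pm :: "('h \<Rightarrow> 'h \<Rightarrow> complex) \<Rightarrow> 'h \<Rightarrow> 'h \<Rightarrow> complex" where
  "Re_pm B = (\<lambda>f g. (B f g + adj_pm B f g) / 2)"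

definition Im_pm :: "('h \<Rightarrow> 'h \<Rightarrow> complex) \<Rightarrow> 'h \<Rightarrow> 'h \<Rightarrow> complex" where
  "Im_pm B = (\<lambda>f g. (B f g - adj_pm B f g) / (2 * \<i>))"

definition extends_op ::
    "'h::complex_hilbert graph \<Rightarrow> ('h \<Rightarrow> 'h \<Rightarrow> complex) \<Rightarrow> 'h graph \<Rightarrow> bool" where
  "extends_op A B T \<longleftrightarrow> (\<forall>(f, f')\<in>T. f \<in> H_plus A \<and> B f = emb A f')"

definition quasi_kernel ::
    "'h::complex_hilbert graph \<Rightarrow> ('h \<Rightarrow> 'h \<Rightarrow> complex) \<Rightarrow> 'h graph" where
  "quasi_kernel A B = {(f, f'). f \<in> H_plus A \<and> B f = emb A f'}"

definition ops_C_minus ::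
    "'h::complex_hilbert graph \<Rightarrow> (complex \<Rightarrow> 'h \<Rightarrow> complex) set" where
  "ops_C_minus A = {K.
     (\<forall>c. K c \<in> H_minus A)
     \<and> (\<forall>c d. K (c + d) = (\<lambda>h. K c h + K d h))
     \<and> (\<forall>c d. K (c * d) = (\<lambda>h. c * K d h))
     \<and> (\<exists>C. \<forall>c. norm_minus A (K c) \<le> C * cmod c)}"

text \<open>The adjoint of \<open>K\<close>, from \<open>H_plus A\<close> to the complex numbers, determined by
  \<open>(K c, f) = c * cnj (K* f)\<close>.\<close>

definition adj_channel :: "(complex \<Rightarrow> 'h \<Rightarrow> complex) \<Rightarrow> 'h \<Rightarrow> complex" where
  "adj_channel K f = cnj (K 1 f)"


section \<open>L-systems with input-output space the complex numbers and J = 1\<close>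

record 'h l_system =
  symm_op :: "'h graph"
  main_op :: "'h graph"
  state_op :: "'h \<Rightarrow> 'h \<Rightarrow> complex"
  channel_op :: "complex \<Rightarrow> 'h \<Rightarrow> complex"

definition admissible_main_op ::
    "'h::complex_hilbert graph \<Rightarrow> 'h graph \<Rightarrow> bool" where
  "admissible_main_op A T \<longleftrightarrow>
     linear_operator T \<and> \<not> symmetric_op T \<and> A \<subseteq> T \<and> T \<subseteq> adjoint_op A
     \<and> resolvent_set T \<noteq> {} \<and> Domain A = Domain T \<inter> Domain (adjoint_op T)"

definition star_extension ::
    "'h::complex_hilbert graph \<Rightarrow> 'h graph \<Rightarrow> ('h \<Rightarrow> 'h \<Rightarrow> complex) \<Rightarrow> bool" where
  "star_extension A T B \<longleftrightarrow> B \<in> ops_plus_minus A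
     \<and> A \<subseteq> T \<and> extends_op A B T
     \<and> A \<subseteq> adjoint_op T \<and> extends_op A (adj_pm B) (adjoint_op T)
     \<and> self_adjoint_in UNIV (quasi_kernel A (Re_pm B))"

definition is_L_system :: "'h::complex_hilbert l_system \<Rightarrow> bool" where
  "is_L_system \<Theta> \<longleftrightarrow>
     (let A = symm_op \<Theta>; T = main_op \<Theta>; B = state_op \<Theta>; K = channel_op \<Theta> in
        symmetric_op A \<and> closed A \<and> deficiency_indices_1_1 A
        \<and> admissible_main_op A T
        \<and> star_extension A T B
        \<and> K \<in> ops_C_minus A
        \<and> Im_pm B = (\<lambda>f. K (adj_channel K f))
        \<and> range K = Im_pm B ` H_plus A)"

definition minimal_L_system :: "'h::complex_hilbert l_system \<Rightarrow> bool" where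
  "minimal_L_system \<Theta> \<longleftrightarrow> is_L_system \<Theta> \<and> prime_op (symm_op \<Theta>)"

text \<open>The operator \<open>Re B - z\<close> does not map onto \<open>H_minus A\<close>, but for an L-system and \<open>z\<close> in the
  resolvent set of the quasi-kernel it is injective on \<open>H_plus A\<close> and its range contains that of
  \<open>K\<close>; the impedance only uses the inverse there. A linear map on the complex numbers is
  identified with its value at 1.\<close>

definition impedance :: "'h::complex_hilbert l_system \<Rightarrow> complex \<Rightarrow> complex" where
  "impedance \<Theta> z =
     (let A = symm_op \<Theta>; B = state_op \<Theta>; K = channel_op \<Theta> in
        adj_channel K
          (inv_into (H_plus A) (\<lambda>f g. Re_pm B f g - z * emb A f g) (K 1)))"

definition realizes :: "'h::complex_hilbert l_system \<Rightarrow> (complex \<Rightarrow> complex) \<Rightarrow> bool" where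
  "realizes \<Theta> V \<longleftrightarrow> (\<forall>z. Im z \<noteq> 0 \<longrightarrow> V z = impedance \<Theta> z)"


section \<open>The function classes\<close>

definition herglotz_integral :: "real measure \<Rightarrow> complex \<Rightarrow> complex" where
  "herglotz_integral \<mu> z =
     (LINT t|\<mu>. 1 / (complex_of_real t - z) - complex_of_real (t / (1 + t\<^sup>2)))"

definition infinite_borel_measure :: "real measure \<Rightarrow> bool" where
  "infinite_borel_measure \<mu> \<longleftrightarrow> sets \<mu> = sets borel \<and> emeasure \<mu> UNIV = \<infinity>"

definition class_M :: "(complex \<Rightarrow> complex) set" where
  "class_M = {V. \<exists>\<mu>. infinite_borel_measure \<mu>
     \<and> (\<integral>\<^sup>+ t. ennreal (1 / (1 + t\<^sup>2)) \<partial>\<mu>) = 1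
     \<and> (\<forall>z. Im z \<noteq> 0 \<longrightarrow> V z = herglotz_integral \<mu> z)}"

definition class_N :: "real \<Rightarrow> (complex \<Rightarrow> complex) set" where
  "class_N Q = {V. \<exists>\<mu>. infinite_borel_measure \<mu>
     \<and> (\<integral>\<^sup>+ t. ennreal (1 / (1 + t\<^sup>2)) \<partial>\<mu>) < \<infinity>
     \<and> (\<forall>z. Im z \<noteq> 0 \<longrightarrow> V z = complex_of_real Q + herglotz_integral \<mu> z)}"

end

theory Submission
  imports Defs
begin

text \<open>By von Neumann's formula \<open>Dom A\<close> has codimension two in \<open>H_plus A = Dom A*\<close>. An L-system over
  \<open>A\<close> is the same thing as a pair of linear functionals \<open>G0\<close>, \<open>G1\<close> on \<open>H_plus A\<close>, unique up to a
  common unimodular factor, with Green's formula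
  \<open>(A* f, g) - (f, A* g) = G1 f * cnj (G0 g) - G0 f * cnj (G1 g)\<close>: the main operator is \<open>A*\<close> on
  \<open>G0 + \<i> G1 = 0\<close>, the quasi-kernel of the real part is \<open>A*\<close> on \<open>G0 = 0\<close>, \<open>K* = G1\<close>, and the
  impedance at \<open>z\<close> is \<open>G1 f / G0 f\<close> for any deficiency vector \<open>f\<close> at \<open>z\<close>. Passing from \<open>V\<^sub>0\<close> to
  \<open>Q + a V\<^sub>0\<close> replaces \<open>(G0, G1)\<close> by \<open>(G0 / sqrt a, sqrt a G1 + Q G0 / sqrt a)\<close>, which keeps Green's
  formula. Conversely, since \<open>V\<^sub>0 \<i> = \<i>\<close>, Green's formula for deficiency vectors at \<open>z\<close> and \<open>- \<i>\<close>
  shows that the Livsic function vanishes wherever \<open>V\<^sub>0 = \<i>\<close>. If it is not identically zero, the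
  impedance takes two different values in the upper half-plane, and these determine the pair.\<close>

section \<open>Complex Hilbert spaces\<close>

instance complex_hilbert \<subseteq> banach ..

lemma cinner_zero_left [simp]: "cinner 0 (y::'a::complex_hilbert) = 0"
  using cinner_add_left[of 0 0 y] by simp

lemma cinner_zero_right [simp]: "cinner (x::'a::complex_hilbert) 0 = 0"
  by (subst cinner_commute) simp

lemma cinner_add_right: "cinner (x::'a::complex_hilbert) (y + z) = cinner x y + cinner x z"
  by (subst (1 2 3) cinner_commute) (simp add: cinner_add_left)

lemma cinner_diff_left: "cinner (x - y) (z::'a::complex_hilbert) = cinner x z - cinner y z"
  using cinner_add_left[of "x - y" y z] by simp

lemma cinner_diff_right: "cinner (x::'a::complex_hilbert) (y - z) = cinner x y - cinner x z"
  using cinner_add_right[of x "y - z" z] by simp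

lemma cinner_scaleC_right:
  "cinner (x::'a::complex_hilbert) (scaleC c y) = cnj c * cinner x y"
  by (subst (1 2) cinner_commute) (simp add: cinner_scaleC_left)

lemmas cinner_simps = cinner_add_left cinner_add_right cinner_diff_left cinner_diff_right
  cinner_scaleC_left cinner_scaleC_right

lemma cinner_self: "cinner x x = complex_of_real ((norm (x::'a::complex_hilbert))\<^sup>2)"
proof (rule complex_eqI)
  show "Im (cinner x x) = Im (complex_of_real ((norm x)\<^sup>2))"
    using arg_cong[OF cinner_commute[of x x], of Im] by simp
qed (simp add: Re_cinner power2_norm_eq_inner)

lemma cinner_self_eq_0 [simp]: "cinner x x = 0 \<longleftrightarrow> (x::'a::complex_hilbert) = 0"
  by (simp add: cinner_self)

lemma norm_scaleC: "norm (scaleC c (x::'a::complex_hilbert)) = cmod c * norm x"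
proof -
  have "complex_of_real ((norm (scaleC c x))\<^sup>2) = (c * cnj c) * cinner x x"
    unfolding cinner_self[symmetric] by (simp add: cinner_scaleC_left cinner_scaleC_right)
  also have "\<dots> = of_real ((cmod c * norm x)\<^sup>2)"
    by (simp only: complex_norm_square[symmetric] cinner_self of_real_mult[symmetric]
        power_mult_distrib)
  finally show ?thesis
    by (simp only: of_real_eq_iff) (simp add: power2_eq_iff_nonneg)
qed

text \<open>A unimodular factor on \<open>x\<close> makes the inner product real and nonnegative,
  which reduces the bound to the real Cauchy-Schwarz inequality.\<close>

lemma cinner_Cauchy_Schwarz: "cmod (cinner x y) \<le> norm x * norm (y::'a::complex_hilbert)"
proof (cases "cinner x y = 0")
  case False
  define c where "c = cnj (cinner x y) / cmod (cinner x y)"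
  have c: "cmod c = 1"
    using False by (simp add: c_def norm_divide)
  have "c * cinner x y = cmod (cinner x y)"
    using False complex_norm_square[of "cinner x y"]
    by (simp add: c_def field_simps power2_eq_square)
  then have "cmod (cinner x y) = scaleC c x \<bullet> y"
    by (metis Re_cinner Re_complex_of_real cinner_scaleC_left)
  also have "\<dots> \<le> norm (scaleC c x) * norm y"
    by (rule norm_cauchy_schwarz)
  finally show ?thesis
    by (simp add: norm_scaleC c)
qed simp

section \<open>Density and orthogonal projection\<close>

lemma scaleR_eq_scaleC: "r *\<^sub>R (x::'a::complex_hilbert) = scaleC (complex_of_real r) x"
  by (simp add: scaleC_of_real)

lemma dense_orthogonal_eq_0:
  fixes h :: "'a::complex_hilbert"
  assumes "closure S = UNIV" and "\<And>a. a \<in> S \<Longrightarrow> cinner a h = 0"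
  shows "h = 0"
proof -
  have "S \<subseteq> {x. x \<bullet> h = 0}"
    using assms(2) by (auto simp flip: Re_cinner)
  moreover have "closed {x. x \<bullet> h = 0}"
    by (intro closed_Collect_eq continuous_intros)
  ultimately have "closure S \<subseteq> {x. x \<bullet> h = 0}"
    by (rule closure_minimal)
  then show ?thesis
    using assms(1) by (auto dest: subsetD[where c = h])
qed

text \<open>A minimizing sequence for the distance from \<open>h\<close> to \<open>S\<close> is
  Cauchy by the parallelogram law; its limit is a nearest point, and minimality in each direction
  \<open>u\<close> gives orthogonality.\<close>

lemma orthogonal_projection_exists:
  fixes h :: "'a::{real_inner, complete_space}"
  assumes "closed S" and "subspace S"
  shows "\<exists>s\<in>S. \<forall>u\<in>S. u \<bullet> (h - s) = 0"
proof -
  define d where "d = infdist h S"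
  have ne: "S \<noteq> {}" and d0: "0 \<le> d"
    using assms(2) subspace_0 by (auto simp: d_def infdist_nonneg)
  have d_le: "d \<le> norm (h - u)" if "u \<in> S" for u
    using infdist_le[OF that, of h] by (simp add: d_def dist_norm)
  have "\<exists>u\<in>S. norm (h - u) < d + 1 / real (Suc n)" for n
  proof (rule ccontr)
    assume "\<not> ?thesis"
    then have "d + 1 / real (Suc n) \<le> (INF a\<in>S. dist h a)"
      by (intro cINF_greatest ne) (auto simp: dist_norm not_less)
    then have "d + 1 / real (Suc n) \<le> d"
      using ne by (simp add: d_def infdist_notempty)
    then show False by (simp add: field_simps)
  qed
  then obtain s where s: "\<And>n. s n \<in> S" "\<And>n. norm (h - s n) < d + 1 / real (Suc n)"
    by metis
  have parallelogram: "(norm (s m - s n))\<^sup>2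
      \<le> 2 * (norm (h - s m))\<^sup>2 + 2 * (norm (h - s n))\<^sup>2 - 4 * d\<^sup>2" for m n
  proof -
    \<comment> \<open>The midpoint of two approximants stays in \<open>S\<close>, so its distance to
      \<open>h\<close> is at least \<open>d\<close>.\<close>
    define x where "x = (1/2) *\<^sub>R (s m + s n)"
    have "x \<in> S"
      unfolding x_def using s assms(2) by (intro subspace_scale subspace_add)
    then have "d\<^sup>2 \<le> (norm (h - x))\<^sup>2"
      using d_le d0 by (intro power_mono) auto
    moreover have "(norm (s m - s n))\<^sup>2
        = 2 * (norm (h - s m))\<^sup>2 + 2 * (norm (h - s n))\<^sup>2 - 4 * (norm (h - x))\<^sup>2"
      by (simp add: x_def power2_norm_eq_inner inner_simps inner_commute field_simps)
    ultimately show ?thesis by simp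
  qed
  have lim: "(\<lambda>n. norm (h - s n)) \<longlonglongrightarrow> d"
  proof (rule tendsto_sandwich)
    show "\<forall>\<^sub>F n in sequentially. d \<le> norm (h - s n)"
      using d_le s(1) by simp
    show "\<forall>\<^sub>F n in sequentially. norm (h - s n) \<le> d + 1 / real (Suc n)"
      using s(2) by (simp add: less_imp_le)
    show "(\<lambda>n. d + 1 / real (Suc n)) \<longlonglongrightarrow> d"
      using tendsto_add[OF tendsto_const LIMSEQ_Suc[OF lim_1_over_n], of d] by simp
  qed simp
  have "Cauchy s"
  proof (rule metric_CauchyI)
    fix e :: real assume "0 < e"
    have "(\<lambda>n. (norm (h - s n))\<^sup>2) \<longlonglongrightarrow> d\<^sup>2"
      using lim by (intro tendsto_intros)
    then have "\<forall>\<^sub>F n in sequentially. (norm (h - s n))\<^sup>2 < d\<^sup>2 + e\<^sup>2 / 4"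
      by (rule order_tendstoD) (use \<open>0 < e\<close> in simp)
    then obtain M where M: "\<And>n. n \<ge> M \<Longrightarrow> (norm (h - s n))\<^sup>2 < d\<^sup>2 + e\<^sup>2 / 4"
      by (auto simp: eventually_sequentially)
    have "dist (s m) (s n) < e" if "m \<ge> M" "n \<ge> M" for m n
    proof -
      have "(norm (s m - s n))\<^sup>2 < e\<^sup>2"
        using parallelogram[of m n] M[OF that(1)] M[OF that(2)] by simp
      then show ?thesis
        using \<open>0 < e\<close> by (simp add: dist_norm power_less_imp_less_base)
    qed
    then show "\<exists>M. \<forall>m\<ge>M. \<forall>n\<ge>M. dist (s m) (s n) < e" by blast
  qed
  then obtain l where l: "s \<longlonglongrightarrow> l"
    by (auto simp: Cauchy_convergent_iff convergent_def)
  have "l \<in> S"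
    using assms(1) s(1) l by (rule closed_sequentially)
  have norm_l: "norm (h - l) = d"
    by (rule LIMSEQ_unique[OF _ lim]) (intro tendsto_intros l)
  have "u \<bullet> (h - l) = 0" if "u \<in> S" for u
  proof (cases "u = 0")
    case False
    \<comment> \<open>This \<open>t\<close> minimizes the distance from \<open>h\<close> to the line
      through \<open>l\<close> in direction \<open>u\<close>.\<close>
    define t where "t = u \<bullet> (h - l) / (u \<bullet> u)"
    have "l + t *\<^sub>R u \<in> S"
      using \<open>l \<in> S\<close> that assms(2) by (intro subspace_add subspace_scale)
    then have "d\<^sup>2 \<le> (norm (h - (l + t *\<^sub>R u)))\<^sup>2"
      using d_le d0 by (intro power_mono) auto
    also have "\<dots> = (norm ((h - l) - t *\<^sub>R u))\<^sup>2"
      by (simp add: algebra_simps)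
    also have "\<dots> = d\<^sup>2 - 2 * t * (u \<bullet> (h - l)) + t * t * (u \<bullet> u)"
      unfolding norm_l[symmetric] power2_norm_eq_inner inner_diff_left[of "h - l"]
        inner_diff_right[of _ "h - l"] by (simp add: inner_commute)
    also have "\<dots> = d\<^sup>2 - (u \<bullet> (h - l))\<^sup>2 / (u \<bullet> u)"
      using False by (simp add: t_def power2_eq_square)
    finally have "(u \<bullet> (h - l))\<^sup>2 / (u \<bullet> u) \<le> 0" by simp
    moreover have "u \<bullet> u > 0"
      using False by simp
    ultimately show ?thesis
      by (simp add: divide_le_0_iff)
  qed simp
  then show ?thesis
    using \<open>l \<in> S\<close> by blast
qed

text \<open>A complex subspace is a real one, and the imaginary part of the inner product with
  \<open>u\<close> is, up to sign, the real part of that with \<open>scaleC \<i> u\<close>.\<close>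

lemma complex_orthogonal_projection_exists:
  fixes h :: "'a::complex_hilbert"
  assumes "closed S" and S: "complex_vector.subspace S"
  shows "\<exists>s\<in>S. \<forall>u\<in>S. cinner u (h - s) = 0"
proof -
  have "subspace S"
    using complex_vector.subspace_0[OF S] complex_vector.subspace_add[OF S]
      complex_vector.subspace_scale[OF S]
    by (simp add: subspace_def scaleR_eq_scaleC)
  then obtain s where s: "s \<in> S" "\<And>u. u \<in> S \<Longrightarrow> u \<bullet> (h - s) = 0"
    using orthogonal_projection_exists[OF assms(1), of h] by auto
  have "cinner u (h - s) = 0" if "u \<in> S" for u
  proof (rule complex_eqI)
    show "Re (cinner u (h - s)) = Re 0"
      using s(2)[OF that] by (simp add: Re_cinner)
    have "Re (cinner (scaleC \<i> u) (h - s)) = 0"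
      using s(2)[OF complex_vector.subspace_scale[OF S that]] by (simp add: Re_cinner)
    then show "Im (cinner u (h - s)) = Im 0"
      by (simp add: cinner_scaleC_left)
  qed
  then show ?thesis using s(1) by blast
qed

lemma dim_1_multiple:
  fixes S :: "'a::complex_hilbert set"
  assumes S: "complex_vector.subspace S" and dim: "complex_vector.dim S = 1"
    and v: "v \<in> S" "v \<noteq> 0" and x: "x \<in> S"
  shows "\<exists>c. x = scaleC c v"
proof -
  obtain B where B: "B \<subseteq> S" "complex_vector.independent B" "S \<subseteq> complex_vector.span B"
      "card B = complex_vector.dim S"
    using complex_vector.basis_exists by blast
  then obtain b where "B = {b}"
    using dim card_1_singletonE by metis
  then have "\<exists>k. y = scaleC k b" if "y \<in> S" for y
    using B(3) that by (auto simp: complex_vector.span_singleton)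
  then obtain k k' where k: "v = scaleC k b" "x = scaleC k' b"
    using v x by metis
  then have "x = scaleC (k' / k) v"
    using v(2) by auto
  then show ?thesis by blast
qed


section \<open>Symmetric operators with deficiency indices (1,1)\<close>

lemma symmetric_opD:
  assumes "symmetric_op A"
  shows "linear_operator A" "closure (Domain A) = UNIV" "A \<subseteq> adjoint_op A"
  using assms by (auto simp: symmetric_op_def)

lemma linear_operatorD:
  assumes "linear_operator T"
  shows "(0, 0) \<in> T"
    and "(f, f') \<in> T \<Longrightarrow> (g, g') \<in> T \<Longrightarrow> (f + g, f' + g') \<in> T"
    and "(f, f') \<in> T \<Longrightarrow> (scaleC c f, scaleC c f') \<in> T"
    and "(f, f') \<in> T \<Longrightarrow> (f, f'') \<in> T \<Longrightarrow> f' = f''"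
  using assms unfolding linear_operator_def single_valued_def split_beta
  by (blast, metis fst_conv snd_conv, metis fst_conv snd_conv, blast)

lemma mem_adjoint_op:
  "(g, g') \<in> adjoint_op T \<longleftrightarrow> (\<forall>(f, f')\<in>T. cinner f' g = cinner f g')"
  by (simp add: adjoint_in_def)

locale symmetric_op_11 =
  fixes A :: "'h::complex_hilbert graph" and gp gm :: 'h
  assumes symm: "symmetric_op A" and closed_A: "closed A"
    and indices: "deficiency_indices_1_1 A"
    and gp: "gp \<in> deficiency_space A \<i>" "gp \<noteq> 0"
    and gm: "gm \<in> deficiency_space A (- \<i>)" "gm \<noteq> 0"
begin

section \<open>The adjoint as a linear map and its boundary form\<close>

abbreviation D :: "'h set" where "D \<equiv> H_plus A"

abbreviation As :: "'h \<Rightarrow> 'h" where "As \<equiv> apply_op (adjoint_op A)"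

text \<open>The boundary form measures the failure of the adjoint to be symmetric; it is zero when
  its first argument lies in \<open>Domain A\<close> and its second in \<open>D\<close>.\<close>

definition omega :: "'h \<Rightarrow> 'h \<Rightarrow> complex" where
  "omega f g = cinner (As f) g - cinner f (As g)"

lemmas linear_A = symmetric_opD(1)[OF symm]
  and dense_A = symmetric_opD(2)[OF symm]
  and A_le_adjoint = symmetric_opD(3)[OF symm]

text \<open>Two images of \<open>f\<close> have a difference orthogonal to the dense set
  \<open>Domain A\<close>.\<close>

lemma adjoint_unique: "(f, f') \<in> adjoint_op A \<Longrightarrow> (f, f'') \<in> adjoint_op A \<Longrightarrow> f' = f''"
proof -
  assume "(f, f') \<in> adjoint_op A" "(f, f'') \<in> adjoint_op A"
  then have "cinner a (f' - f'') = 0" if "a \<in> Domain A" for a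
    using that by (fastforce simp: mem_adjoint_op cinner_diff_right)
  then show ?thesis
    using dense_orthogonal_eq_0[OF dense_A] by force
qed

lemma As_eq: "(f, f') \<in> adjoint_op A \<Longrightarrow> As f = f'"
  unfolding apply_op_def using adjoint_unique by blast

lemma adjoint_iff: "(f, f') \<in> adjoint_op A \<longleftrightarrow> f \<in> D \<and> f' = As f"
  using As_eq by (auto simp: H_plus_def)

lemma As_A: "(a, a') \<in> A \<Longrightarrow> a \<in> D \<and> As a = a'"
  using A_le_adjoint adjoint_iff by (metis subsetD)

lemma A_mem: "a \<in> Domain A \<Longrightarrow> (a, As a) \<in> A"
  using As_A by blast

lemma A_iff: "(a, a') \<in> A \<longleftrightarrow> a \<in> Domain A \<and> a' = As a"
  using As_A A_mem by blast

lemma Domain_A_le: "a \<in> Domain A \<Longrightarrow> a \<in> D"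
  using As_A by blast

lemma adjoint_A: "a \<in> Domain A \<Longrightarrow> f \<in> D \<Longrightarrow> cinner (As a) f = cinner a (As f)"
  using A_mem[of a] adjoint_iff[of f "As f"] by (auto simp: mem_adjoint_op)

lemma adjoint_A': "a \<in> Domain A \<Longrightarrow> f \<in> D \<Longrightarrow> cinner (As f) a = cinner f (As a)"
  by (subst (1 2) cinner_commute) (simp add: adjoint_A)

lemma adjoint_add:
  assumes "f \<in> D" "g \<in> D"
  shows "f + g \<in> D" and "As (f + g) = As f + As g"
proof -
  have "(f + g, As f + As g) \<in> adjoint_op A"
    using adjoint_A[OF _ assms(1)] adjoint_A[OF _ assms(2)]
    by (auto simp: mem_adjoint_op cinner_add_right A_iff)
  then show "f + g \<in> D" and "As (f + g) = As f + As g"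
    by (auto simp: adjoint_iff)
qed

lemma adjoint_scaleC:
  assumes "f \<in> D"
  shows "scaleC c f \<in> D" and "As (scaleC c f) = scaleC c (As f)"
proof -
  have "(scaleC c f, scaleC c (As f)) \<in> adjoint_op A"
    using adjoint_A[OF _ assms] by (auto simp: mem_adjoint_op cinner_scaleC_right A_iff)
  then show "scaleC c f \<in> D" and "As (scaleC c f) = scaleC c (As f)"
    by (auto simp: adjoint_iff)
qed

lemma adjoint_diff:
  assumes "f \<in> D" "g \<in> D"
  shows "f - g \<in> D" and "As (f - g) = As f - As g"
  using adjoint_add[of f "scaleC (- 1) g"] adjoint_scaleC[of g "- 1"] assms by simp_all

lemma zero_in_D [simp]: "0 \<in> D"
  using linear_operatorD(1)[OF linear_A] As_A by blast

lemma deficiency_iff: "f \<in> deficiency_space A z \<longleftrightarrow> f \<in> D \<and> As f = scaleC z f"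
  by (auto simp: deficiency_space_def adjoint_iff)

lemma gp_D: "gp \<in> D" "As gp = scaleC \<i> gp" and gm_D: "gm \<in> D" "As gm = scaleC (- \<i>) gm"
  using gp gm by (auto simp: deficiency_iff)

lemma omega_add_left: "f \<in> D \<Longrightarrow> g \<in> D \<Longrightarrow> omega (f + g) h = omega f h + omega g h"
  and omega_scaleC_left: "f \<in> D \<Longrightarrow> omega (scaleC c f) h = c * omega f h"
  by (simp_all add: omega_def adjoint_add adjoint_scaleC cinner_simps algebra_simps)

lemma omega_A_left: "a \<in> Domain A \<Longrightarrow> f \<in> D \<Longrightarrow> omega a f = 0"
  by (simp add: omega_def adjoint_A)

lemma omega_deficiency:
  assumes "f \<in> deficiency_space A z" "h \<in> deficiency_space A w"
  shows "omega f h = (z - cnj w) * cinner f h"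
  using assms by (simp add: omega_def deficiency_iff cinner_simps algebra_simps)

lemma omega_gp_gp: "omega gp gp = 2 * \<i> * (norm gp)\<^sup>2"
  and omega_gm_gm: "omega gm gm = - 2 * \<i> * (norm gm)\<^sup>2"
  and omega_gp_gm: "omega gp gm = 0"
  and omega_gm_gp: "omega gm gp = 0"
  using gp gm by (simp_all add: omega_deficiency cinner_self)

section \<open>Deficiency vectors and von Neumann's formula\<close>

lemma deficiency_subspace: "complex_vector.subspace (deficiency_space A z)"
  unfolding complex_vector.subspace_def
  by (auto simp: deficiency_iff adjoint_add adjoint_scaleC complex_vector.scale_right_distrib
      complex_vector.scale_left_commute) (use As_eq[of 0 0] mem_adjoint_op in force)

lemma deficiency_multiple:
  shows "f \<in> deficiency_space A \<i> \<Longrightarrow> \<exists>c. f = scaleC c gp"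
    and "f \<in> deficiency_space A (- \<i>) \<Longrightarrow> \<exists>c. f = scaleC c gm"
  using indices dim_1_multiple[OF deficiency_subspace _ gp]
    dim_1_multiple[OF deficiency_subspace _ gm]
  unfolding deficiency_indices_1_1_def by blast+

text \<open>Symmetry makes \<open>A + \<i>\<close> isometric for the graph norm, so its range is
  closed because \<open>A\<close> is; the orthogonal complement of the range lies in the deficiency
  space at \<open>\<i>\<close>, which is spanned by \<open>gp\<close>.\<close>

lemma range_decomposition: "\<exists>a\<in>Domain A. \<exists>x. h = As a + scaleC \<i> a + scaleC x gp"
proof -
  define F where "F = (\<lambda>p :: 'h \<times> 'h. snd p + scaleC \<i> (fst p))"
  have bl: "bounded_linear F"
  proof (rule bounded_linear_intro)
    show "F (p + q) = F p + F q" for p q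
      by (simp add: F_def complex_vector.scale_right_distrib)
    show "F (r *\<^sub>R p) = r *\<^sub>R F p" for r p
      by (simp add: F_def scaleR_eq_scaleC complex_vector.scale_right_distrib
          complex_vector.scale_left_commute)
    show "norm (F p) \<le> norm p * 2" for p
      using norm_triangle_ineq[of "snd p" "scaleC \<i> (fst p)"] norm_fst_le[of "fst p" "snd p"]
        norm_snd_le[of "snd p" "fst p"]
      by (simp add: F_def norm_scaleC)
  qed
  have isometry: "norm (F p) = norm p" if "p \<in> A" for p
  proof -
    obtain a a' where p: "p = (a, a')" by fastforce
    \<comment> \<open>Symmetry of \<open>A\<close> cancels the two cross terms in the square of the
      norm.\<close>
    have "cinner a' a = cinner a a'"
      using that p As_A[of a a'] adjoint_A[of a a] by auto
    then have "cinner (F p) (F p) = cinner a' a' + cinner a a"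
      by (simp add: F_def p cinner_simps algebra_simps)
    then have "(norm (F p))\<^sup>2 = (norm a')\<^sup>2 + (norm a)\<^sup>2"
      unfolding cinner_self by (metis of_real_add of_real_eq_iff)
    then show ?thesis
      by (simp add: p norm_prod_def add.commute real_sqrt_unique)
  qed
  have "subspace A"
    using linear_operatorD[OF linear_A]
    by (auto simp: subspace_def scaleR_eq_scaleC zero_prod_def)
  moreover have "complete A"
    using closed_A by (simp add: complete_eq_closed)
  ultimately have "complete (F ` A)"
    using isometry by (intro complete_isometric_image[where e = 1]) (auto simp: bl)
  then have "closed (F ` A)"
    by (simp add: complete_eq_closed)
  moreover have "complex_vector.subspace (F ` A)"
  proof (rule complex_vector.subspaceI)
    show "0 \<in> F ` A"
      using linear_operatorD(1)[OF linear_A] by (force simp: F_def)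
    fix x assume "x \<in> F ` A"
    then obtain a a' where a: "(a, a') \<in> A" "x = a' + scaleC \<i> a"
      by (auto simp: F_def)
    then show "scaleC c x \<in> F ` A" for c
      using linear_operatorD(3)[OF linear_A a(1), of c]
      by (intro image_eqI[where x = "(scaleC c a, scaleC c a')"])
        (auto simp: F_def a complex_vector.scale_right_distrib mult.commute)
    fix y assume "y \<in> F ` A"
    then obtain b b' where b: "(b, b') \<in> A" "y = b' + scaleC \<i> b"
      by (auto simp: F_def)
    then show "x + y \<in> F ` A"
      using linear_operatorD(2)[OF linear_A a(1) b(1)] a
      by (intro image_eqI[where x = "(a + b, a' + b')"])
        (auto simp: F_def b complex_vector.scale_right_distrib)
  qed
  ultimately obtain s where s: "s \<in> F ` A" "\<And>u. u \<in> F ` A \<Longrightarrow> cinner u (h - s) = 0"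
    using complex_orthogonal_projection_exists[of "F ` A" h] by auto
  obtain a a' where a: "(a, a') \<in> A" "s = a' + scaleC \<i> a"
    using s(1) by (auto simp: F_def)
  have "(h - s, scaleC \<i> (h - s)) \<in> adjoint_op A"
    unfolding mem_adjoint_op
  proof safe
    fix b b' assume "(b, b') \<in> A"
    then have "b' + scaleC \<i> b \<in> F ` A"
      by (force simp: F_def)
    then show "cinner b' (h - s) = cinner b (scaleC \<i> (h - s))"
      using s(2)[of "b' + scaleC \<i> b"] by (simp add: cinner_simps algebra_simps)
  qed
  then have "h - s \<in> deficiency_space A \<i>"
    by (simp add: deficiency_space_def)
  then obtain x where "h - s = scaleC x gp"
    using deficiency_multiple by blast
  then have "h = As a + scaleC \<i> a + scaleC x gp"
    using a As_A by (auto simp: diff_eq_eq add.commute)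
  then show ?thesis using a(1) by blast
qed

text \<open>The range decomposition is applied to \<open>A* f + \<i> f\<close>. Since
  \<open>A* + \<i>\<close> multiplies \<open>gp\<close> by \<open>2 * \<i>\<close>, subtracting
  \<open>a\<close> and a suitable multiple of \<open>gp\<close> from \<open>f\<close> leaves a
  vector in the kernel of \<open>A* + \<i>\<close>.\<close>

lemma von_Neumann:
  assumes "f \<in> D"
  shows "\<exists>a\<in>Domain A. \<exists>x y. f = a + scaleC x gp + scaleC y gm"
proof -
  obtain a x where a: "a \<in> Domain A"
    and x: "As f + scaleC \<i> f = As a + scaleC \<i> a + scaleC x gp"
    using range_decomposition by blast
  define c where "c = x / (2 * \<i>)"
  have x_eq: "x = c * \<i> + \<i> * c"
    by (simp add: c_def field_simps)
  have c: "scaleC x gp = scaleC c (scaleC \<i> gp) + scaleC \<i> (scaleC c gp)"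
    by (subst x_eq) (simp only: scaleC_add_left scaleC_scaleC)
  define r where "r = f - (a + scaleC c gp)"
  have "r \<in> D" and Asr: "As r = As f - (As a + scaleC c (scaleC \<i> gp))"
    using assms Domain_A_le[OF a] gp_D
    by (simp_all add: r_def adjoint_add adjoint_diff adjoint_scaleC)
  have "As r + scaleC \<i> r = (As f + scaleC \<i> f) - (As a + scaleC \<i> a + scaleC x gp)"
    unfolding Asr c unfolding r_def
    by (simp add: complex_vector.scale_right_diff_distrib complex_vector.scale_right_distrib)
  then have "As r = scaleC (- \<i>) r"
    using x by (simp add: add_eq_0_iff2)
  then have "r \<in> deficiency_space A (- \<i>)"
    using \<open>r \<in> D\<close> by (simp add: deficiency_iff)
  then obtain y where "r = scaleC y gm"
    using deficiency_multiple by blast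
  then have "f = a + scaleC c gp + scaleC y gm"
    by (simp add: r_def diff_eq_eq add.commute)
  then show ?thesis using a by blast
qed

text \<open>The boundary form is diagonal on \<open>gp\<close>, \<open>gm\<close> with nonzero
  diagonal entries, so it reads off both coefficients in von Neumann's formula.\<close>

lemma Domain_A_if_omega_0:
  assumes "f \<in> D" "omega f gp = 0" "omega f gm = 0"
  shows "f \<in> Domain A"
proof -
  obtain a x y where f: "a \<in> Domain A" "f = a + scaleC x gp + scaleC y gm"
    using von_Neumann[OF assms(1)] by blast
  have "omega f gp = x * omega gp gp" "omega f gm = y * omega gm gm"
    using f gp_D gm_D Domain_A_le[OF f(1)]
    by (simp_all add: omega_add_left omega_scaleC_left adjoint_add adjoint_scaleC omega_A_left
        omega_gp_gm omega_gm_gp)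
  then have "x = 0" "y = 0"
    using assms gp gm by (auto simp: omega_gp_gp omega_gm_gm)
  then show ?thesis using f by simp
qed

text \<open>Needed for the resolvent of the main operator: the \<open>gp\<close> component in the
  range decomposition is reached by \<open>A* + \<i>\<close> from a multiple of \<open>gp\<close>
  itself.\<close>

lemma adjoint_surj: "\<exists>f\<in>D. h = As f + scaleC \<i> f"
proof -
  obtain a x where a: "a \<in> Domain A" and h: "h = As a + scaleC \<i> a + scaleC x gp"
    using range_decomposition by blast
  define c where "c = x / (2 * \<i>)"
  have x_eq: "x = c * \<i> + \<i> * c"
    by (simp add: c_def field_simps)
  have c: "scaleC x gp = scaleC c (scaleC \<i> gp) + scaleC \<i> (scaleC c gp)"
    by (subst x_eq) (simp only: scaleC_add_left scaleC_scaleC)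
  have "h = As (a + scaleC c gp) + scaleC \<i> (a + scaleC c gp)"
    using Domain_A_le[OF a] gp_D unfolding h c
    by (simp add: adjoint_add adjoint_scaleC complex_vector.scale_right_distrib)
  moreover have "a + scaleC c gp \<in> D"
    using Domain_A_le[OF a] gp_D by (simp add: adjoint_add adjoint_scaleC)
  ultimately show ?thesis by blast
qed

section \<open>Continuity in the norm of \<open>H_plus A\<close>\<close>

lemma norm_As_le:
  assumes "f \<in> D"
  shows "norm f \<le> norm_plus A f" and "norm (As f) \<le> norm_plus A f"
proof -
  have "norm_plus A f = sqrt ((norm f)\<^sup>2 + (norm (As f))\<^sup>2)"
    by (simp add: norm_plus_def inner_plus_def cinner_self)
  then show "norm f \<le> norm_plus A f" and "norm (As f) \<le> norm_plus A f"
    by (simp_all add: real_le_rsqrt)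
qed

lemma cmod_omega_le:
  assumes "f \<in> D"
  shows "cmod (omega f g) \<le> (norm g + norm (As g)) * norm_plus A f"
proof -
  have "cmod (omega f g) \<le> norm (As f) * norm g + norm f * norm (As g)"
    unfolding omega_def
    by (rule norm_triangle_ineq4[THEN order_trans] add_mono cinner_Cauchy_Schwarz)+
  also have "\<dots> \<le> norm_plus A f * norm g + norm_plus A f * norm (As g)"
    using norm_As_le[OF assms] by (intro add_mono mult_right_mono) auto
  finally show ?thesis by (simp add: algebra_simps)
qed

end


section \<open>L-systems from boundary triplets\<close>

text \<open>The element \<open>h + c * K 1\<close> of \<open>H_minus A\<close>, where
  \<open>K\<close> is the channel with adjoint \<open>G1\<close>; the conjugate makes it antilinear
  in \<open>g\<close>.\<close>

definition bdry_functional ::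
    "'h::complex_hilbert graph \<Rightarrow> ('h \<Rightarrow> complex) \<Rightarrow> 'h \<Rightarrow> complex \<Rightarrow> 'h \<Rightarrow> complex" where
  "bdry_functional A G1 h c = (\<lambda>g. if g \<in> H_plus A then cinner h g + c * cnj (G1 g) else 0)"

text \<open>The parameter \<open>\<i>\<close> gives the main operator, \<open>- \<i>\<close> its
  adjoint and \<open>0\<close> the quasi-kernel of the real part.\<close>

definition bdry_restriction ::
    "'h::complex_hilbert graph \<Rightarrow> ('h \<Rightarrow> complex) \<Rightarrow> ('h \<Rightarrow> complex) \<Rightarrow> complex \<Rightarrow> 'h graph" where
  "bdry_restriction A G0 G1 c = {(f, f') \<in> adjoint_op A. G0 f + c * G1 f = 0}"

text \<open>The state operator sends \<open>f\<close> to
  \<open>A* f + (G0 f + \<i> * G1 f) * K 1\<close>. Off \<open>H_plus A\<close> it is set to zero,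
  as membership in \<open>ops_plus_minus A\<close> requires.\<close>

definition bdry_system ::
    "'h::complex_hilbert graph \<Rightarrow> ('h \<Rightarrow> complex) \<Rightarrow> ('h \<Rightarrow> complex) \<Rightarrow> 'h l_system" where
  "bdry_system A G0 G1 =
     \<lparr>symm_op = A,
      main_op = bdry_restriction A G0 G1 \<i>,
      state_op = (\<lambda>f. if f \<in> H_plus A
        then bdry_functional A G1 (apply_op (adjoint_op A) f) (G0 f + \<i> * G1 f) else (\<lambda>_. 0)),
      channel_op = bdry_functional A G1 0\<rparr>"

text \<open>Green's formula is the only condition linking the two functionals; surjectivity of the
  pair, vanishing on \<open>Domain A\<close> and continuity are derived from it.\<close>

locale boundary_triplet = symmetric_op_11 +
  fixes G0 G1 :: "'a \<Rightarrow> complex"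
  assumes G0_add: "f \<in> D \<Longrightarrow> g \<in> D \<Longrightarrow> G0 (f + g) = G0 f + G0 g"
    and G1_add: "f \<in> D \<Longrightarrow> g \<in> D \<Longrightarrow> G1 (f + g) = G1 f + G1 g"
    and G0_scaleC: "f \<in> D \<Longrightarrow> G0 (scaleC c f) = c * G0 f"
    and G1_scaleC: "f \<in> D \<Longrightarrow> G1 (scaleC c f) = c * G1 f"
    and green: "f \<in> D \<Longrightarrow> g \<in> D \<Longrightarrow> omega f g = G1 f * cnj (G0 g) - G0 f * cnj (G1 g)"
begin

section \<open>Boundary values and Weyl quotients\<close>

lemmas G_linear = G0_add G1_add G0_scaleC G1_scaleC

lemma G_diff:
  assumes "f \<in> D" "g \<in> D"
  shows "G0 (f - g) = G0 f - G0 g" and "G1 (f - g) = G1 f - G1 g"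
  using G_linear(1,2)[of f "scaleC (- 1) g"] G_linear(3,4)[of g "- 1"] adjoint_scaleC(1)[of g "- 1"]
    assms by simp_all

lemma Im_deficiency:
  assumes "f \<in> deficiency_space A z"
  shows "Im (G1 f * cnj (G0 f)) = Im z * (norm f)\<^sup>2"
proof -
  have "omega f f = (z - cnj z) * (norm f)\<^sup>2"
    using omega_deficiency[OF assms assms] by (simp add: cinner_self)
  moreover have "omega f f = G1 f * cnj (G0 f) - G0 f * cnj (G1 f)"
    using assms by (simp add: green deficiency_iff)
  ultimately have "Im (G1 f * cnj (G0 f) - G0 f * cnj (G1 f)) = Im ((z - cnj z) * (norm f)\<^sup>2)"
    by simp
  then show ?thesis by (simp add: algebra_simps)
qed

lemma G0_deficiency_neq_0:
  assumes "f \<in> deficiency_space A z" "f \<noteq> 0" "Im z \<noteq> 0"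
  shows "G0 f \<noteq> 0"
  using Im_deficiency[OF assms(1)] assms by auto

lemma weyl_quotient_sign:
  assumes "f \<in> deficiency_space A z" "f \<noteq> 0"
  shows "Im z > 0 \<Longrightarrow> Im (G1 f / G0 f) > 0" and "Im z < 0 \<Longrightarrow> Im (G1 f / G0 f) < 0"
  using Im_deficiency[OF assms(1)] assms(2)
  by (simp_all add: Im_complex_div_gt_0 Im_complex_div_lt_0 mult_neg_pos)

text \<open>A zero determinant would make the Weyl quotients at \<open>gp\<close> and
  \<open>gm\<close> equal, but they lie in opposite half-planes.\<close>

lemma G_det_neq_0: "G0 gp * G1 gm - G1 gp * G0 gm \<noteq> 0"
proof
  assume "G0 gp * G1 gm - G1 gp * G0 gm = 0"
  moreover have "G0 gp \<noteq> 0" "G0 gm \<noteq> 0"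
    using G0_deficiency_neq_0 gp gm by auto
  ultimately have "G1 gp / G0 gp = G1 gm / G0 gm"
    by (simp add: field_simps)
  moreover have "Im (G1 gp / G0 gp) > 0" "Im (G1 gm / G0 gm) < 0"
    using weyl_quotient_sign(1)[OF gp] weyl_quotient_sign(2)[OF gm] by simp_all
  ultimately show False by simp
qed

text \<open>Cramer's rule in the span of \<open>gp\<close> and \<open>gm\<close>.\<close>

lemma G_surj: "\<exists>f\<in>D. G0 f = x \<and> G1 f = y"
proof -
  define d where "d = G0 gp * G1 gm - G1 gp * G0 gm"
  define p where "p = (x * G1 gm - y * G0 gm) / d"
  define q where "q = (G0 gp * y - G1 gp * x) / d"
  have d: "d \<noteq> 0"
    using G_det_neq_0 by (simp add: d_def)
  have pq: "p * d = x * G1 gm - y * G0 gm" "q * d = G0 gp * y - G1 gp * x"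
    using d by (simp_all add: p_def q_def)
  have "(p * G0 gp + q * G0 gm) * d = (p * d) * G0 gp + (q * d) * G0 gm"
    "(p * G1 gp + q * G1 gm) * d = (p * d) * G1 gp + (q * d) * G1 gm"
    by (simp_all add: algebra_simps)
  then have "(p * G0 gp + q * G0 gm) * d = x * d" "(p * G1 gp + q * G1 gm) * d = y * d"
    unfolding pq by (simp_all add: d_def algebra_simps)
  then have "G0 (scaleC p gp + scaleC q gm) = x" "G1 (scaleC p gp + scaleC q gm) = y"
    using d gp_D gm_D by (simp_all add: G_linear adjoint_scaleC)
  then show ?thesis
    using gp_D gm_D adjoint_add adjoint_scaleC by blast
qed

text \<open>Pairing \<open>a\<close> with vectors of boundary values \<open>(1, 0)\<close> and
  \<open>(0, 1)\<close> isolates each functional in Green's formula, whose left side is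
  zero.\<close>

lemma G_A:
  assumes "a \<in> Domain A"
  shows "G0 a = 0" and "G1 a = 0"
proof -
  obtain e e' where e: "e \<in> D" "G0 e = 1" "G1 e = 0" "e' \<in> D" "G0 e' = 0" "G1 e' = 1"
    using G_surj[of 1 0] G_surj[of 0 1] by blast
  show "G0 a = 0"
    using green[of a e'] e omega_A_left[OF assms] Domain_A_le[OF assms] by simp
  show "G1 a = 0"
    using green[of a e] e omega_A_left[OF assms] Domain_A_le[OF assms] by simp
qed

lemma G_kernel: "f \<in> D \<Longrightarrow> G0 f = 0 \<Longrightarrow> G1 f = 0 \<Longrightarrow> f \<in> Domain A"
  using gp_D gm_D by (intro Domain_A_if_omega_0) (simp_all add: green)

text \<open>Up to sign, \<open>G0\<close> and \<open>G1\<close> are boundary forms against fixed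
  vectors, and these are continuous in the norm of \<open>H_plus A\<close>.\<close>

lemma G_bounded:
  obtains C where "C \<ge> 0" "\<And>f. f \<in> D \<Longrightarrow> cmod (G0 f) \<le> C * norm_plus A f"
    "\<And>f. f \<in> D \<Longrightarrow> cmod (G1 f) \<le> C * norm_plus A f"
proof -
  obtain e e' where e: "e \<in> D" "G0 e = 1" "G1 e = 0" "e' \<in> D" "G0 e' = 0" "G1 e' = 1"
    using G_surj[of 1 0] G_surj[of 0 1] by blast
  define C where "C = (norm e + norm (As e)) + (norm e' + norm (As e'))"
  have C: "norm e + norm (As e) \<le> C" "norm e' + norm (As e') \<le> C" "C \<ge> 0"
    by (simp_all add: C_def)
  have np: "norm_plus A f \<ge> 0" if "f \<in> D" for f
    using norm_As_le(1)[OF that] norm_ge_zero order_trans by blast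
  show ?thesis
  proof (rule that[OF C(3)])
    fix f assume f: "f \<in> D"
    have "cmod (G0 f) = cmod (omega f e')" "cmod (G1 f) = cmod (omega f e)"
      using e f by (simp_all add: green)
    then show "cmod (G0 f) \<le> C * norm_plus A f" "cmod (G1 f) \<le> C * norm_plus A f"
      using cmod_omega_le[OF f, of e] cmod_omega_le[OF f, of e']
        mult_right_mono[OF C(1) np[OF f]] mult_right_mono[OF C(2) np[OF f]] by auto
  qed
qed

section \<open>Functionals in \<open>H_minus A\<close>\<close>

abbreviation functional :: "'a \<Rightarrow> complex \<Rightarrow> 'a \<Rightarrow> complex" where
  "functional \<equiv> bdry_functional A G1"

lemma functional_apply: "g \<in> D \<Longrightarrow> functional h c g = cinner h g + c * cnj (G1 g)"
  and functional_outside: "g \<notin> D \<Longrightarrow> functional h c g = 0"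
  by (simp_all add: bdry_functional_def)

lemma functional_add: "functional (h + h') (c + c') = (\<lambda>g. functional h c g + functional h' c' g)"
  and functional_scaleC: "functional (scaleC b h) (b * c) = (\<lambda>g. b * functional h c g)"
  by (auto simp: bdry_functional_def cinner_simps algebra_simps)

text \<open>Testing on the dense \<open>Domain A\<close>, where \<open>G1\<close> vanishes, recovers
  \<open>h\<close>; a vector with \<open>G1 g = 1\<close> then recovers \<open>c\<close>.\<close>

lemma functional_eq_iff: "functional h c = functional h' c' \<longleftrightarrow> h = h' \<and> c = c'"
proof
  assume eq: "functional h c = functional h' c'"
  then have eq': "cinner h g + c * cnj (G1 g) = cinner h' g + c' * cnj (G1 g)" if "g \<in> D" for g
    using that by (metis eq functional_apply)
  have "cinner a (h - h') = 0" if "a \<in> Domain A" for a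
    using eq'[OF Domain_A_le[OF that]] G_A[OF that]
    by (subst cinner_commute) (simp add: cinner_diff_left)
  then have "h = h'"
    using dense_orthogonal_eq_0[OF dense_A, of "h - h'"] by simp
  moreover obtain g where "g \<in> D" "G1 g = 1"
    using G_surj by blast
  ultimately show "h = h' \<and> c = c'"
    using eq'[of g] by simp
qed simp

lemma emb_eq: "emb A h = functional h 0"
  by (simp add: emb_def bdry_functional_def fun_eq_iff)

lemma cmod_functional_le:
  assumes "\<And>g. g \<in> D \<Longrightarrow> cmod (G1 g) \<le> C * norm_plus A g" and "g \<in> D"
  shows "cmod (functional h c g) \<le> (norm h + cmod c * C) * norm_plus A g"
proof -
  have "cmod (functional h c g) \<le> norm h * norm g + cmod c * cmod (G1 g)"
    using norm_triangle_ineq[of "cinner h g" "c * cnj (G1 g)"] cinner_Cauchy_Schwarz[of h g] assms(2)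
    by (simp add: functional_apply norm_mult)
  also have "\<dots> \<le> norm h * norm_plus A g + cmod c * (C * norm_plus A g)"
    using assms norm_As_le(1) by (intro add_mono mult_left_mono) auto
  finally show ?thesis by (simp add: algebra_simps)
qed

lemma functional_in_H_minus: "functional h c \<in> H_minus A"
proof -
  obtain C where "\<And>g. g \<in> D \<Longrightarrow> cmod (G1 g) \<le> C * norm_plus A g"
    using G_bounded by metis
  from cmod_functional_le[OF this]
  have "\<exists>C. \<forall>g\<in>D. cmod (functional h c g) \<le> C * norm_plus A g" by blast
  then show ?thesis
    by (auto simp: H_minus_def functional_apply functional_outside adjoint_add adjoint_scaleC
        G_linear cinner_simps algebra_simps)
qed

lemma norm_minus_functional_le:
  assumes "C \<ge> 0" and "\<And>g. g \<in> D \<Longrightarrow> cmod (G1 g) \<le> C * norm_plus A g"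
  shows "norm_minus A (functional h c) \<le> norm h + cmod c * C"
  unfolding norm_minus_def
proof (rule cSup_least)
  \<comment> \<open>The supremum bound needs a nonempty set; the zero vector supplies a
    member.\<close>
  have "As 0 = 0"
    using adjoint_scaleC(2)[of 0 0] by simp
  then have "norm_plus A 0 = 0"
    by (simp add: norm_plus_def inner_plus_def)
  then show "{cmod (functional h c f) |f. f \<in> D \<and> norm_plus A f \<le> 1} \<noteq> {}"
    by (auto intro!: exI[of _ 0])
next
  fix x assume "x \<in> {cmod (functional h c f) |f. f \<in> D \<and> norm_plus A f \<le> 1}"
  then obtain f where f: "x = cmod (functional h c f)" "f \<in> D" "norm_plus A f \<le> 1" by blast
  have "x \<le> (norm h + cmod c * C) * norm_plus A f"
    using cmod_functional_le[OF assms(2) f(2)] f(1) by simp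
  also have "\<dots> \<le> (norm h + cmod c * C) * 1"
    using f(3) assms(1) by (intro mult_left_mono) auto
  finally show "x \<le> norm h + cmod c * C" by simp
qed

section \<open>Restrictions of the adjoint by a boundary condition\<close>

abbreviation restriction :: "complex \<Rightarrow> 'a graph" where
  "restriction \<equiv> bdry_restriction A G0 G1"

lemma mem_restriction:
  "(f, f') \<in> restriction c \<longleftrightarrow> f \<in> D \<and> f' = As f \<and> G0 f + c * G1 f = 0"
  using adjoint_iff by (auto simp: bdry_restriction_def)

lemma A_le_restriction: "A \<subseteq> restriction c"
  using G_A Domain_A_le by (auto simp: mem_restriction A_iff)

lemma linear_operator_restriction: "linear_operator (restriction c)"
  unfolding linear_operator_def
proof (intro conjI)
  show "single_valued (restriction c)"
    by (auto simp: single_valued_def mem_restriction)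
  show "(0, 0) \<in> restriction c"
    using linear_operatorD(1)[OF linear_A] A_le_restriction by blast
  have "G0 f + c * G1 f + (G0 g + c * G1 g) = 0"
    if "G0 f + c * G1 f = 0" "G0 g + c * G1 g = 0" for f g
    using that by simp
  then show "\<forall>(f, f')\<in>restriction c. \<forall>(g, g')\<in>restriction c. (f + g, f' + g') \<in> restriction c"
    by (auto simp: mem_restriction adjoint_add G_linear algebra_simps)
  have "b * G0 f + c * (b * G1 f) = 0" if "G0 f + c * G1 f = 0" for f b
    using arg_cong[OF that, of "(*) b"] by (simp add: algebra_simps)
  then show "\<forall>b. \<forall>(f, f')\<in>restriction c. (scaleC b f, scaleC b f') \<in> restriction c"
    by (auto simp: mem_restriction adjoint_scaleC G_linear)
qed

text \<open>For \<open>f\<close> in the restriction,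
  \<open>omega f g = G1 f * cnj (G0 g + cnj c * G1 g)\<close>, and \<open>G1 f\<close> takes the
  value one there.\<close>

lemma adjoint_restriction: "adjoint_op (restriction c) = restriction (cnj c)"
proof (rule set_eqI, rule iffI; clarify)
  fix g g' assume g: "(g, g') \<in> adjoint_op (restriction c)"
  then have "(g, g') \<in> adjoint_op A"
    using A_le_restriction by (auto simp: mem_adjoint_op)
  then have gD: "g \<in> D" "g' = As g"
    by (simp_all add: adjoint_iff)
  obtain f where f: "f \<in> D" "G0 f = - c" "G1 f = 1"
    using G_surj by blast
  then have "(f, As f) \<in> restriction c"
    by (simp add: mem_restriction)
  then have "omega f g = 0"
    using g gD by (auto simp: omega_def mem_adjoint_op)
  then have "cnj (cnj (G0 g) + c * cnj (G1 g)) = 0"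
    using f gD by (simp add: green)
  then show "(g, g') \<in> restriction (cnj c)"
    using gD by (simp add: mem_restriction)
next
  fix g g' assume "(g, g') \<in> restriction (cnj c)"
  then have g: "g \<in> D" "g' = As g" "cnj (G0 g + cnj c * G1 g) = 0"
    by (simp_all add: mem_restriction)
  have "cinner f' g = cinner f g'" if "(f, f') \<in> restriction c" for f f'
  proof -
    have f: "f \<in> D" "f' = As f" "G0 f = - c * G1 f"
      using that by (auto simp: mem_restriction add_eq_0_iff2)
    have "omega f g = G1 f * cnj (G0 g + cnj c * G1 g)"
      using f g(1) by (simp add: green algebra_simps)
    then show ?thesis
      using f g by (simp add: omega_def)
  qed
  then show "(g, g') \<in> adjoint_op (restriction c)"
    by (auto simp: mem_adjoint_op)
qed

lemma closure_Domain_restriction: "closure (Domain (restriction c)) = UNIV"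
  using dense_A closure_mono[of "Domain A" "Domain (restriction c)"] A_le_restriction[of c] by blast

lemma self_adjoint_restriction: "self_adjoint_in UNIV (restriction 0)"
  using linear_operator_restriction adjoint_restriction[of 0] closure_Domain_restriction
  by (simp add: self_adjoint_in_def)

section \<open>The L-system of a triplet and its impedance\<close>

abbreviation Theta :: "'a l_system" where
  "Theta \<equiv> bdry_system A G0 G1"

lemma Theta_simps [simp]: "symm_op Theta = A" "main_op Theta = restriction \<i>"
  "channel_op Theta = functional 0"
  by (simp_all add: bdry_system_def)

lemma state_op_Theta: "f \<in> D \<Longrightarrow> state_op Theta f = functional (As f) (G0 f + \<i> * G1 f)"
  and state_op_Theta_outside: "f \<notin> D \<Longrightarrow> state_op Theta f = (\<lambda>_. 0)"
  by (simp_all add: bdry_system_def)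

text \<open>Green's formula rewrites the terms in \<open>A* g\<close> and \<open>G0 g\<close>
  through \<open>A* f\<close> and \<open>G0 f\<close>; compared with the state operator only the
  sign of \<open>\<i> * G1 f\<close> changes.\<close>

lemma adj_state_op_Theta:
  assumes "f \<in> D"
  shows "adj_pm (state_op Theta) f = functional (As f) (G0 f - \<i> * G1 f)"
proof
  fix g
  show "adj_pm (state_op Theta) f g = functional (As f) (G0 f - \<i> * G1 f) g"
  proof (cases "g \<in> D")
    case True
    have "cnj (cinner (As g) f) = cinner (As f) g - omega f g"
      by (simp add: omega_def flip: cinner_commute)
    then show ?thesis
      using assms True
      by (simp add: adj_pm_def state_op_Theta functional_apply green algebra_simps)
  qed (simp add: adj_pm_def state_op_Theta_outside functional_outside)
qed

lemma Re_state_op_Theta: "f \<in> D \<Longrightarrow> Re_pm (state_op Theta) f = functional (As f) (G0 f)"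
  by (auto simp: Re_pm_def adj_state_op_Theta state_op_Theta bdry_functional_def field_simps)

lemma Im_state_op_Theta: "f \<in> D \<Longrightarrow> Im_pm (state_op Theta) f = functional 0 (G1 f)"
  by (auto simp: Im_pm_def adj_state_op_Theta state_op_Theta bdry_functional_def field_simps)

lemma Im_state_op_Theta_outside: "f \<notin> D \<Longrightarrow> Im_pm (state_op Theta) f = (\<lambda>_. 0)"
  unfolding Im_pm_def adj_pm_def
  using state_op_Theta state_op_Theta_outside functional_outside
  by (metis complex_cnj_zero diff_self div_0)

text \<open>The coefficient of \<open>K 1\<close> in the real part at \<open>f\<close> is
  \<open>G0 f\<close>, and by \<open>functional_eq_iff\<close> it has to vanish for a value in the
  Hilbert space.\<close>

lemma quasi_kernel_Theta: "quasi_kernel A (Re_pm (state_op Theta)) = restriction 0"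
  by (auto simp: quasi_kernel_def mem_restriction Re_state_op_Theta emb_eq functional_eq_iff)

text \<open>The operator is dissipative: Green's formula makes \<open>Im (cinner f' f)\<close> the
  squared modulus of \<open>G1 f\<close>, which bounds \<open>f\<close> by
  \<open>f' + \<i> f\<close>. For surjectivity, a solution of the equation for the adjoint is
  corrected by a multiple of \<open>gm\<close>, which \<open>A* + \<i>\<close> annihilates.\<close>

lemma resolvent_set_restriction: "- \<i> \<in> resolvent_set (restriction \<i>)"
proof -
  have bound: "norm f \<le> norm (f' + scaleC \<i> f)" if "(f, f') \<in> restriction \<i>" for f f'
  proof (cases "f = 0")
    case False
    have f: "f \<in> D" "f' = As f" "G0 f = - \<i> * G1 f"
      using that by (auto simp: mem_restriction add_eq_0_iff2)
    have "omega f f = 2 * \<i> * (G1 f * cnj (G1 f))"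
      using f by (simp add: green)
    also have "\<dots> = 2 * \<i> * of_real ((cmod (G1 f))\<^sup>2)"
      by (simp only: complex_norm_square)
    finally have "Im (omega f f) \<ge> 0"
      by simp
    moreover have "omega f f = cinner f' f - cnj (cinner f' f)"
      using f by (simp add: omega_def flip: cinner_commute)
    ultimately have "Im (cinner f' f) \<ge> 0"
      by simp
    then have "(norm f)\<^sup>2 \<le> Im (cinner (f' + scaleC \<i> f) f)"
      by (simp add: cinner_simps cinner_self)
    also have "\<dots> \<le> norm (f' + scaleC \<i> f) * norm f"
      using abs_Im_le_cmod cinner_Cauchy_Schwarz order_trans abs_ge_self by metis
    finally show ?thesis
      using False by (simp add: power2_eq_square)
  qed simp
  have surj: "\<exists>f. \<exists>f'. (f, f') \<in> restriction \<i> \<and> f' + scaleC \<i> f = h" for h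
  proof -
    obtain k where k: "k \<in> D" "h = As k + scaleC \<i> k"
      using adjoint_surj by blast
    \<comment> \<open>If \<open>gm\<close> satisfied the boundary condition, its Weyl quotient would
      be \<open>\<i>\<close>, in the wrong half-plane.\<close>
    have "Im (G1 gm / G0 gm) < 0"
      using weyl_quotient_sign(2)[OF gm] by simp
    then have gm0: "G0 gm + \<i> * G1 gm \<noteq> 0"
      using G0_deficiency_neq_0[OF gm] by (auto simp: add_eq_0_iff2)
    define c where "c = (G0 k + \<i> * G1 k) / (G0 gm + \<i> * G1 gm)"
    have "c * (G0 gm + \<i> * G1 gm) = G0 k + \<i> * G1 k"
      using gm0 by (simp add: c_def)
    then have "(k - scaleC c gm, As (k - scaleC c gm)) \<in> restriction \<i>"
      using k gm_D by (simp add: mem_restriction adjoint_diff adjoint_scaleC G_diff G_linear algebra_simps)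
    moreover have "As (k - scaleC c gm) + scaleC \<i> (k - scaleC c gm) = h"
      using k gm_D by (simp add: adjoint_diff adjoint_scaleC
          complex_vector.scale_right_diff_distrib mult.commute)
    ultimately show ?thesis by blast
  qed
  have uniq: "f = g" if "(f, f') \<in> restriction \<i>" "(g, g') \<in> restriction \<i>"
    "f' + scaleC \<i> f = g' + scaleC \<i> g" for f f' g g'
  proof -
    have "(f - g, f' - g') \<in> restriction \<i>"
      using linear_operatorD(2)[OF linear_operator_restriction that(1)
          linear_operatorD(3)[OF linear_operator_restriction that(2), of "- 1"]] by simp
    from bound[OF this] show ?thesis
      using that(3) by (simp add: complex_vector.scale_right_diff_distrib algebra_simps)
  qed
  show ?thesis
    unfolding resolvent_set_def mem_Collect_eq
  proof (intro conjI allI)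
    fix h show "\<exists>!f. \<exists>f'. (f, f') \<in> restriction \<i> \<and> f' - scaleC (- \<i>) f = h"
      using surj[of h] uniq by (simp) blast
    show "\<exists>C. \<forall>(f, f')\<in>restriction \<i>. norm f \<le> C * norm (f' - scaleC (- \<i>) f)"
      using bound by (intro exI[of _ 1]) auto
  qed
qed

lemma admissible_restriction: "admissible_main_op A (restriction \<i>)"
  unfolding admissible_main_op_def
proof (intro conjI)
  show "\<not> symmetric_op (restriction \<i>)"
  proof
    assume "symmetric_op (restriction \<i>)"
    then have le: "restriction \<i> \<subseteq> restriction (- \<i>)"
      by (metis symmetric_opD(3) adjoint_restriction complex_cnj_i)
    \<comment> \<open>These boundary values satisfy the condition for \<open>\<i>\<close>, while the
      one for \<open>- \<i>\<close> evaluates to \<open>- 2 * \<i>\<close>.\<close>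
    obtain f where f: "f \<in> D" "G0 f = - \<i>" "G1 f = 1"
      using G_surj by blast
    then have "(f, As f) \<in> restriction (- \<i>)"
      by (intro subsetD[OF le]) (simp add: mem_restriction)
    then show False
      using f by (simp add: mem_restriction)
  qed
  show "Domain A = Domain (restriction \<i>) \<inter> Domain (adjoint_op (restriction \<i>))"
  proof
    show "Domain A \<subseteq> Domain (restriction \<i>) \<inter> Domain (adjoint_op (restriction \<i>))"
      using A_le_restriction[of \<i>] A_le_restriction[of "- \<i>"] adjoint_restriction[of \<i>] by auto
    show "Domain (restriction \<i>) \<inter> Domain (adjoint_op (restriction \<i>)) \<subseteq> Domain A"
    proof safe
      fix f f' f'' assume "(f, f') \<in> restriction \<i>" "(f, f'') \<in> adjoint_op (restriction \<i>)"
      then have f: "f \<in> D" "G0 f + \<i> * G1 f = 0" "G0 f - \<i> * G1 f = 0"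
        using adjoint_restriction[of \<i>] by (auto simp: mem_restriction)
      have "G0 f = 0"
        using arg_cong2[OF f(2,3), of "(+)"] by simp
      then show "f \<in> Domain A"
        using f by (intro G_kernel) simp_all
    qed
  qed
  show "restriction \<i> \<subseteq> adjoint_op A"
    by (auto simp: bdry_restriction_def)
qed (use linear_operator_restriction A_le_restriction resolvent_set_restriction in auto)

lemma state_op_in_ops: "state_op Theta \<in> ops_plus_minus A"
proof -
  obtain C where C: "C \<ge> 0" "\<And>f. f \<in> D \<Longrightarrow> cmod (G0 f) \<le> C * norm_plus A f"
    "\<And>f. f \<in> D \<Longrightarrow> cmod (G1 f) \<le> C * norm_plus A f"
    using G_bounded by metis
  have "norm_minus A (state_op Theta f) \<le> (1 + (C + C) * C) * norm_plus A f" if f: "f \<in> D" for f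
  proof -
    have "norm_minus A (state_op Theta f) \<le> norm (As f) + cmod (G0 f + \<i> * G1 f) * C"
      using norm_minus_functional_le[OF C(1,3)] f by (simp add: state_op_Theta)
    also have "\<dots> \<le> norm_plus A f + (C * norm_plus A f + C * norm_plus A f) * C"
      using norm_triangle_ineq[of "G0 f" "\<i> * G1 f"] C(2,3)[OF f] norm_As_le(2)[OF f] C(1)
      by (intro add_mono mult_right_mono) (simp_all add: norm_mult)
    finally show ?thesis by (simp add: algebra_simps)
  qed
  moreover have "state_op Theta (f + g) = (\<lambda>h. state_op Theta f h + state_op Theta g h)"
    if "f \<in> D" "g \<in> D" for f g
    using that functional_add[of "As f" "As g" "G0 f + \<i> * G1 f" "G0 g + \<i> * G1 g"]
    by (simp add: state_op_Theta adjoint_add G_linear algebra_simps)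
  moreover have "state_op Theta (scaleC c f) = (\<lambda>h. c * state_op Theta f h)" if "f \<in> D" for c f
    using that functional_scaleC[of c "As f" "G0 f + \<i> * G1 f"]
    by (simp add: state_op_Theta adjoint_scaleC G_linear algebra_simps)
  ultimately show ?thesis
    unfolding ops_plus_minus_def mem_Collect_eq
    using state_op_Theta_outside functional_in_H_minus
    by (intro conjI) (auto simp: state_op_Theta)
qed

lemma channel_op_in_ops: "functional 0 \<in> ops_C_minus A"
proof -
  obtain C where C: "C \<ge> 0" "\<And>f. f \<in> D \<Longrightarrow> cmod (G1 f) \<le> C * norm_plus A f"
    using G_bounded by metis
  have "\<forall>c. norm_minus A (functional 0 c) \<le> C * cmod c"
    using norm_minus_functional_le[OF C, of 0] by (simp add: mult.commute)
  then show ?thesis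
    using functional_in_H_minus functional_add[of 0 0] functional_scaleC[of _ 0]
    by (auto simp: ops_C_minus_def)
qed

lemma adj_channel_Theta: "f \<in> D \<Longrightarrow> adj_channel (functional 0) f = G1 f"
  and adj_channel_Theta_outside: "f \<notin> D \<Longrightarrow> adj_channel (functional 0) f = 0"
  by (simp_all add: adj_channel_def functional_apply functional_outside)

lemma is_L_system_Theta: "is_L_system Theta"
proof -
  have "star_extension A (restriction \<i>) (state_op Theta)"
    unfolding star_extension_def quasi_kernel_Theta adjoint_restriction
    using state_op_in_ops A_le_restriction self_adjoint_restriction
    by (auto simp: extends_op_def mem_restriction state_op_Theta adj_state_op_Theta emb_eq)
  moreover have "Im_pm (state_op Theta) = (\<lambda>f. functional 0 (adj_channel (functional 0) f))"
  proof
    show "Im_pm (state_op Theta) f = functional 0 (adj_channel (functional 0) f)" for f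
      by (cases "f \<in> D") (auto simp: Im_state_op_Theta adj_channel_Theta
          Im_state_op_Theta_outside adj_channel_Theta_outside bdry_functional_def)
  qed
  moreover have "range (functional 0) = Im_pm (state_op Theta) ` D"
  proof -
    have "G1 ` D = UNIV"
      using G_surj[of 0] by (metis UNIV_eq_I image_eqI)
    then have "range (functional 0) = (\<lambda>f. functional 0 (G1 f)) ` D"
      by (metis image_image)
    also have "\<dots> = Im_pm (state_op Theta) ` D"
      by (intro image_cong) (simp_all add: Im_state_op_Theta)
    finally show ?thesis .
  qed
  ultimately show ?thesis
    using symm closed_A indices admissible_restriction channel_op_in_ops
    by (simp add: is_L_system_def Let_def)
qed

text \<open>The operator \<open>Re B - z\<close> sends \<open>k\<close> to \<open>A* k - z k\<close>
  in the Hilbert space plus \<open>G0 k\<close> times \<open>K 1\<close>. It takes the value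
  \<open>K 1\<close> exactly at the deficiency vector with \<open>G0 k = 1\<close>, where the
  adjoint channel gives \<open>G1 k\<close>.\<close>

lemma impedance_Theta:
  assumes f: "f \<in> deficiency_space A z" "f \<noteq> 0" and z: "Im z \<noteq> 0"
  shows "impedance Theta z = G1 f / G0 f"
proof -
  define F where "F = (\<lambda>f g. Re_pm (state_op Theta) f g - z * emb A f g)"
  have F: "F k = functional (As k - scaleC z k) (G0 k)" if "k \<in> D" for k
    using that by (auto simp: F_def Re_state_op_Theta emb_eq bdry_functional_def cinner_simps)
  \<comment> \<open>\<open>inv_into\<close> picks some preimage, which injectivity identifies. Two
    preimages differ by a deficiency vector with \<open>G0\<close> equal to zero, and this vector is
    zero for nonreal \<open>z\<close>.\<close>
  have "inj_on F D"
  proof (rule inj_onI)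
    fix k l assume kl: "k \<in> D" "l \<in> D" "F k = F l"
    then have "As k - scaleC z k = As l - scaleC z l" "G0 k = G0 l"
      by (simp_all add: F functional_eq_iff)
    then have "k - l \<in> deficiency_space A z" "G0 (k - l) = 0"
      using kl by (simp_all add: deficiency_iff adjoint_diff G_diff
          complex_vector.scale_right_diff_distrib algebra_simps)
    then show "k = l"
      using G0_deficiency_neq_0[of "k - l" z] z by auto
  qed
  define k where "k = scaleC (1 / G0 f) f"
  have fD: "f \<in> D" "As f = scaleC z f"
    using f by (simp_all add: deficiency_iff)
  have k: "k \<in> D" "As k = scaleC z k" "G0 k = 1" "G1 k = G1 f / G0 f"
    using fD G0_deficiency_neq_0[OF f z]
    by (simp_all add: k_def adjoint_scaleC G_linear mult.commute)
  then have "F k = functional 0 1"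
    by (simp add: F)
  then have "inv_into D F (functional 0 1) = k"
    using inv_into_f_f[OF \<open>inj_on F D\<close> k(1)] by simp
  then show ?thesis
    using k by (simp add: impedance_def Let_def F_def adj_channel_Theta)
qed

end


section \<open>Change and uniqueness of triplets\<close>

context boundary_triplet
begin

text \<open>The pair is changed by a real matrix of determinant one, which preserves Green's
  formula. A Weyl quotient \<open>m\<close> becomes \<open>r * r * m + q\<close>.\<close>

lemma affine_triplet:
  fixes r q :: real
  assumes "r \<noteq> 0"
  shows "boundary_triplet A gp gm (\<lambda>f. G0 f / r) (\<lambda>f. r * G1 f + q * (G0 f / r))"
proof
  fix f g assume "f \<in> D" "g \<in> D"
  then show "omega f g = (r * G1 f + q * (G0 f / r)) * cnj (G0 g / r)
      - G0 f / r * cnj (r * G1 g + q * (G0 g / r))"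
    using assms by (simp add: green field_simps)
qed (simp_all add: G_linear algebra_simps add_divide_distrib)

text \<open>A second triplet with the same Weyl quotient at two deficiency vectors is proportional to the
  first one on each of them. Green's formula shows that the two factors are unimodular and equal;
  the vectors span \<open>D\<close> modulo \<open>Domain A\<close> because the quotients differ.\<close>

lemma triplet_unique:
  assumes H: "boundary_triplet A gp gm H0 H1"
    and f: "f \<in> deficiency_space A z" "f \<noteq> 0" "Im z > 0"
    and h: "h \<in> deficiency_space A w" "h \<noteq> 0" "Im w > 0"
    and eqf: "H1 f / H0 f = G1 f / G0 f" and eqh: "H1 h / H0 h = G1 h / G0 h"
    and neq: "G1 f / G0 f \<noteq> G1 h / G0 h"
  shows "\<exists>u. cmod u = 1 \<and> (\<forall>k\<in>D. H0 k = u * G0 k \<and> H1 k = u * G1 k)"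
proof -
  interpret H: boundary_triplet A gp gm H0 H1 by (rule H)
  define v where "v = G1 f / G0 f"
  \<comment> \<open>From here on \<open>w\<close> is the Weyl quotient at \<open>h\<close> and no
    longer the spectral point.\<close>
  define w where "w = G1 h / G0 h"
  have nz: "G0 f \<noteq> 0" "G0 h \<noteq> 0" "H0 f \<noteq> 0" "H0 h \<noteq> 0"
    using G0_deficiency_neq_0[OF f(1,2)] G0_deficiency_neq_0[OF h(1,2)]
      H.G0_deficiency_neq_0[OF f(1,2)] H.G0_deficiency_neq_0[OF h(1,2)] f h by auto
  have G1: "G1 f = v * G0 f" "G1 h = w * G0 h" and H1: "H1 f = v * H0 f" "H1 h = w * H0 h"
    using nz eqf eqh by (simp_all add: v_def w_def field_simps)
  have vw: "Im v > 0" "Im w > 0" "v \<noteq> w"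
    using weyl_quotient_sign(1) f h neq by (simp_all add: v_def w_def)
  define c where "c = H0 f / G0 f"
  define d where "d = H0 h / G0 h"
  have H0: "H0 f = c * G0 f" "H0 h = d * G0 h"
    using nz by (simp_all add: c_def d_def)
  have D: "f \<in> D" "h \<in> D"
    using f h by (simp_all add: deficiency_iff)
  \<comment> \<open>Green's formula for both triplets at the pair \<open>f\<close>,
    \<open>f\<close>.\<close>
  have "(v - cnj v) * (c * cnj c) * (G0 f * cnj (G0 f)) = (v - cnj v) * (G0 f * cnj (G0 f))"
    using H.green[OF D(1,1)] green[OF D(1,1)] by (simp add: G1 H1 H0 algebra_simps)
  moreover have "v - cnj v \<noteq> 0"
    using vw(1) by (auto simp: complex_eq_iff)
  ultimately have cc: "c * cnj c = 1"
    using nz by simp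
  \<comment> \<open>The mixed pair \<open>f\<close>, \<open>h\<close> relates \<open>c\<close> to
    \<open>d\<close>; the factor is nonzero because \<open>v\<close> and \<open>cnj w\<close> lie in
    opposite half-planes.\<close>
  have "(v - cnj w) * (c * cnj d) * (G0 f * cnj (G0 h)) = (v - cnj w) * (G0 f * cnj (G0 h))"
    using H.green[OF D] green[OF D] by (simp add: G1 H1 H0 algebra_simps)
  moreover have "v - cnj w \<noteq> 0"
    using vw by (auto simp: complex_eq_iff)
  ultimately have "c * cnj d = 1"
    using nz by simp
  then have "cnj d = cnj c"
    using cc by (metis mult_cancel_left mult_zero_left zero_neq_one)
  then have "d = c" by simp
  have "H0 k = c * G0 k \<and> H1 k = c * G1 k" if k: "k \<in> D" for k
  proof -
    \<comment> \<open>The coefficients are chosen so that \<open>s\<close> has zero boundary values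
      under \<open>G0\<close> and \<open>G1\<close>; this uses that \<open>v\<close> and
      \<open>w\<close> differ.\<close>
    define y where "y = (G1 k - v * G0 k) / ((w - v) * G0 h)"
    define x where "x = (G0 k - y * G0 h) / G0 f"
    define s where "s = k - (scaleC x f + scaleC y h)"
    have xf: "x * G0 f = G0 k - y * G0 h" and yh: "(w - v) * (y * G0 h) = G1 k - v * G0 k"
      using nz vw(3) by (simp_all add: x_def y_def)
    have w: "scaleC x f + scaleC y h \<in> D"
      using D by (simp add: adjoint_add adjoint_scaleC)
    have G0s: "G0 s = G0 k - (x * G0 f + y * G0 h)"
      using D k w by (simp add: s_def G_diff G_linear adjoint_scaleC)
    have G1s: "G1 s = G1 k - (v * (x * G0 f) + w * (y * G0 h))"
      using D k w by (simp add: s_def G_diff G_linear adjoint_scaleC G1 algebra_simps)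
    have "G0 s = 0" "G1 s = (G1 k - v * G0 k) - (w - v) * (y * G0 h)"
      unfolding G0s G1s xf by (simp_all add: algebra_simps)
    then have "s \<in> Domain A"
      using D k w unfolding yh by (intro G_kernel) (simp_all add: s_def adjoint_diff)
    then have "H0 s = 0" "H1 s = 0" "G0 s = 0" "G1 s = 0"
      using G_A H.G_A by auto
    moreover have "H0 s = H0 k - (x * H0 f + y * H0 h)" "H1 s = H1 k - (x * H1 f + y * H1 h)"
      "G0 s = G0 k - (x * G0 f + y * G0 h)" "G1 s = G1 k - (x * G1 f + y * G1 h)"
      using D k w by (simp_all add: s_def G_diff H.G_diff G_linear H.G_linear adjoint_scaleC)
    ultimately show ?thesis
      by (simp add: G1 H1 H0 \<open>d = c\<close> algebra_simps)
  qed
  moreover have "cmod c = 1"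
    using cc by (metis complex_mod_mult_cnj norm_ge_zero norm_one power2_eq_1_iff power_one_right
        neg_0_le_iff_le not_one_le_zero)
  ultimately show ?thesis by blast
qed

end

text \<open>In the state operator a boundary functional is always multiplied by the conjugate of
  another, where \<open>u * cnj u = 1\<close> cancels the factor; the channel contains a single
  conjugated functional and keeps \<open>cnj u\<close>.\<close>

lemma bdry_system_unimodular:
  assumes u: "cmod u = 1"
    and H: "\<And>k. k \<in> H_plus A \<Longrightarrow> H0 k = u * G0 k \<and> H1 k = u * G1 k"
  shows "main_op (bdry_system A H0 H1) = main_op (bdry_system A G0 G1)"
    and "state_op (bdry_system A H0 H1) = state_op (bdry_system A G0 G1)"
    and "channel_op (bdry_system A H0 H1) = (\<lambda>c. channel_op (bdry_system A G0 G1) (cnj u * c))"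
proof -
  have uu: "u * cnj u = 1"
    using u by (simp flip: complex_norm_square)
  have "H0 f + \<i> * H1 f = u * (G0 f + \<i> * G1 f)" if "f \<in> H_plus A" for f
    using H[OF that] by (simp add: algebra_simps)
  then have "H0 f + \<i> * H1 f = 0 \<longleftrightarrow> G0 f + \<i> * G1 f = 0" if "f \<in> H_plus A" for f
    using u that by (metis mult_eq_0_iff norm_zero zero_neq_one)
  then have "(f, f') \<in> bdry_restriction A H0 H1 \<i> \<longleftrightarrow> (f, f') \<in> bdry_restriction A G0 G1 \<i>" for f f'
    unfolding bdry_restriction_def H_plus_def by blast
  then show "main_op (bdry_system A H0 H1) = main_op (bdry_system A G0 G1)"
    by (auto simp: bdry_system_def)
  have "(u * G0 f + \<i> * (u * G1 f)) * cnj (u * G1 g)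
      = (u * cnj u) * ((G0 f + \<i> * G1 f) * cnj (G1 g))" for f g
    by (simp add: algebra_simps)
  then show "state_op (bdry_system A H0 H1) = state_op (bdry_system A G0 G1)"
    using H uu by (auto simp: bdry_system_def bdry_functional_def fun_eq_iff)
  show "channel_op (bdry_system A H0 H1) = (\<lambda>c. channel_op (bdry_system A G0 G1) (cnj u * c))"
    using H by (auto simp: bdry_system_def bdry_functional_def fun_eq_iff)
qed


section \<open>Every L-system comes from a boundary triplet\<close>

text \<open>With \<open>G1\<close> the adjoint of \<open>K\<close>, the form \<open>R\<close> of
  \<open>Re B - A*\<close> vanishes on \<open>Domain A\<close> and at a vector \<open>u\<close> of
  the quasi-kernel; at a vector \<open>t\<close> of \<open>Domain T\<close> it is a multiple of
  \<open>cnj (G1 g)\<close>. As \<open>t\<close> and \<open>u\<close> span \<open>D\<close> modulo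
  \<open>Domain A\<close>, \<open>R f g\<close> factors as \<open>G0 f * cnj (G1 g)\<close>, and
  Green's formula is the Hermitian symmetry of \<open>Re B\<close>.\<close>

lemma (in symmetric_op_11) L_system_is_bdry_system:
  assumes L: "is_L_system \<Theta>" and symm_op: "symm_op \<Theta> = A"
  shows "\<exists>G0 G1. boundary_triplet A gp gm G0 G1 \<and> \<Theta> = bdry_system A G0 G1"
proof -
  define T where "T = main_op \<Theta>"
  define B where "B = state_op \<Theta>"
  define K where "K = channel_op \<Theta>"
  define G1 where "G1 = adj_channel K"
  have T: "admissible_main_op A T" and star: "star_extension A T B"
    and K: "K \<in> ops_C_minus A" and ImB: "Im_pm B = (\<lambda>f. K (G1 f))"
    using L symm_op by (auto simp: is_L_system_def Let_def T_def B_def K_def G1_def)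
  have K_mult: "K c h = c * K 1 h" for c h
  proof -
    have "K (c * 1) = (\<lambda>h. c * K 1 h)"
      using K unfolding ops_C_minus_def mem_Collect_eq by blast
    then show ?thesis by simp
  qed
  have K1: "K 1 \<in> H_minus A"
    using K by (simp add: ops_C_minus_def)
  have G1_add: "G1 (f + g) = G1 f + G1 g" and G1_scaleC: "G1 (scaleC c f) = c * G1 f"
    if "f \<in> D" "g \<in> D" for f g c
    using K1 that by (simp_all add: G1_def adj_channel_def H_minus_def)
  have K1_eq: "K c h = c * cnj (G1 h)" for c h
    by (subst K_mult) (simp add: G1_def adj_channel_def)
  have K1_outside: "K c h = 0" if "h \<notin> D" for c h
    using K1 that K_mult[of c h] by (simp add: H_minus_def)
  have B: "B \<in> ops_plus_minus A"
    using star by (simp add: star_extension_def)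
  have B_add: "B (f + g) h = B f h + B g h" and B_scaleC: "B (scaleC c f) h = c * B f h"
    if "f \<in> D" "g \<in> D" for f g h c
    using B that by (simp_all add: ops_plus_minus_def)
  have B_outside: "B f g = 0" if "f \<notin> D \<or> g \<notin> D" for f g
    using B that unfolding ops_plus_minus_def H_minus_def mem_Collect_eq by metis
  have B_Im: "B f g - cnj (B g f) = 2 * \<i> * (G1 f * cnj (G1 g))" for f g
    using fun_cong[OF fun_cong[OF ImB, of f], of g]
    by (simp add: Im_pm_def adj_pm_def K1_eq field_simps)
  have linT: "linear_operator T" and AT: "A \<subseteq> T"
    using T by (simp_all add: admissible_main_op_def)
  have T_As: "f \<in> D \<and> f' = As f" if "(f, f') \<in> T" for f f'
    using T that adjoint_iff by (auto simp: admissible_main_op_def)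
  have B_T: "B f g = cinner (As f) g" if "f \<in> Domain T" "g \<in> D" for f g
  proof -
    obtain f' where "(f, f') \<in> T" using \<open>f \<in> Domain T\<close> by blast
    moreover from this have "B f = emb A f'"
      using star by (auto simp: star_extension_def extends_op_def)
    ultimately show ?thesis
      using T_As \<open>g \<in> D\<close> by (auto simp: emb_def)
  qed
  have AT': "Domain A \<subseteq> Domain T"
    using AT by blast
  \<comment> \<open>The second argument of \<open>B\<close> is controlled by the adjoint:
    \<open>adj_pm B\<close> extends the adjoint of \<open>T\<close>, which contains
    \<open>A\<close>.\<close>
  have B_A: "B f a = cinner (As f) a" if "a \<in> Domain A" "f \<in> D" for f a
  proof -
    have "(a, As a) \<in> adjoint_op T"
      using star A_mem[OF that(1)] by (auto simp: star_extension_def)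
    then have "adj_pm B a = emb A (As a)"
      using star by (auto simp: star_extension_def extends_op_def)
    then have "cnj (B f a) = cinner (As a) f"
      using that by (simp add: adj_pm_def emb_def fun_eq_iff)
    then have "B f a = cinner f (As a)"
      by (metis cinner_commute complex_cnj_cnj)
    then show ?thesis
      using adjoint_A' that by simp
  qed
  have G1_A: "G1 a = 0" if "a \<in> Domain A" for a
  proof -
    have "cinner (As a) a = cnj (cinner (As a) a)"
      using adjoint_A[OF that Domain_A_le[OF that]] cinner_commute by metis
    then have "2 * \<i> * (G1 a * cnj (G1 a)) = 0"
      using B_Im[of a a] B_A[OF that Domain_A_le[OF that]] by simp
    then show ?thesis by simp
  qed
  \<comment> \<open>If \<open>G1\<close> vanished on \<open>Domain T\<close>, the form of
    \<open>B\<close> would be Hermitian there and \<open>T\<close> would be symmetric, against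
    admissibility.\<close>
  obtain t where t: "t \<in> Domain T" "G1 t \<noteq> 0"
  proof (rule ccontr)
    assume "\<not> thesis"
    then have G1_T: "G1 f = 0" if "f \<in> Domain T" for f
      using that \<open>\<And>t. t \<in> Domain T \<Longrightarrow> G1 t \<noteq> 0 \<Longrightarrow> thesis\<close> by blast
    have "T \<subseteq> adjoint_op T"
    proof clarify
      fix g g' assume g: "(g, g') \<in> T"
      have "cinner f' g = cinner f g'" if f: "(f, f') \<in> T" for f f'
      proof -
        have "B f g = cinner f' g" "B g f = cinner g' f"
          using B_T[of f g] B_T[of g f] T_As[OF f] T_As[OF g] f g by auto
        then show ?thesis
          using B_Im[of f g] G1_T[OF DomainI[OF f]] by (auto simp flip: cinner_commute)
      qed
      then show "(g, g') \<in> adjoint_op T"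
        by (auto simp: mem_adjoint_op)
    qed
    moreover have "closure (Domain T) = UNIV"
      using dense_A closure_mono[OF AT'] by blast
    ultimately show False
      using T linT by (simp add: admissible_main_op_def symmetric_op_def)
  qed
  have tD: "t \<in> D"
    using t(1) T_As by blast
  define R where "R = (\<lambda>f g. Re_pm B f g - cinner (As f) g)"
  have Re_B: "Re_pm B f g = B f g - \<i> * (G1 f * cnj (G1 g))" for f g
    using B_Im[of f g] by (simp add: Re_pm_def adj_pm_def field_simps)
  have R_add: "R (f + g) h = R f h + R g h" and R_scaleC: "R (scaleC c f) h = c * R f h"
    if "f \<in> D" "g \<in> D" for f g h c
    using that by (simp_all add: R_def Re_B B_add B_scaleC G1_add G1_scaleC adjoint_add adjoint_scaleC
        cinner_simps algebra_simps)
  have R_T: "R f g = - \<i> * G1 f * cnj (G1 g)" if "f \<in> Domain T" "g \<in> D" for f g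
    using that by (simp add: R_def Re_B B_T)
  have R_A: "R a g = 0" if "a \<in> Domain A" "g \<in> D" for a g
    using R_T[of a g] that AT' G1_A by auto
  define Q where "Q = quasi_kernel A (Re_pm B)"
  have selfQ: "linear_operator Q" "adjoint_op Q = Q"
    using star by (auto simp: star_extension_def self_adjoint_in_def Q_def)
  have AQ: "A \<subseteq> Q"
  proof clarify
    fix a a' assume a: "(a, a') \<in> A"
    then have "Re_pm B a g = cinner a' g" if "g \<in> D" for g
      using R_A[of a g] that As_A[OF a] by (auto simp: R_def)
    moreover have "Re_pm B a g = 0" if "g \<notin> D" for g
      using that B_outside by (simp add: Re_pm_def adj_pm_def)
    ultimately show "(a, a') \<in> Q"
      using As_A[OF a] by (auto simp: Q_def quasi_kernel_def emb_def)
  qed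
  have Q_As: "f \<in> D \<and> f' = As f" if "(f, f') \<in> Q" for f f'
  proof -
    \<comment> \<open>\<open>Q\<close> equals its adjoint and contains \<open>A\<close>, so it lies
      in the adjoint of \<open>A\<close>.\<close>
    have "(f, f') \<in> adjoint_op Q"
      using that selfQ(2) by simp
    then have "(f, f') \<in> adjoint_op A"
      using AQ by (auto simp: mem_adjoint_op)
    then show ?thesis by (simp add: adjoint_iff)
  qed
  \<comment> \<open>Otherwise \<open>A\<close> would equal the self-adjoint \<open>Q\<close>, and
    \<open>gp\<close> would lie in \<open>Domain A\<close>, forcing \<open>omega gp gp\<close> to
    vanish.\<close>
  obtain u where u: "u \<in> Domain Q" "u \<notin> Domain A"
  proof (rule ccontr)
    assume "\<not> thesis"
    then have "Domain Q \<subseteq> Domain A"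
      using \<open>\<And>u. u \<in> Domain Q \<Longrightarrow> u \<notin> Domain A \<Longrightarrow> thesis\<close> by blast
    then have "(f, f') \<in> A" if "(f, f') \<in> Q" for f f'
      using Q_As[OF that] that A_iff by blast
    then have "A = Q"
      using AQ by auto
    then have "gp \<in> Domain A"
      using selfQ(2) gp by (auto simp: deficiency_space_def)
    then show False
      using omega_A_left[of gp gp] gp_D gp(2) by (simp add: omega_gp_gp)
  qed
  obtain u' where u': "(u, u') \<in> Q"
    using u(1) by blast
  have uD: "u \<in> D"
    using Q_As[OF u'] by blast
  have "Re_pm B u = emb A u'"
    using u' by (simp add: Q_def quasi_kernel_def)
  then have R_u: "R u g = 0" if "g \<in> D" for g
    using Q_As[OF u'] that by (simp add: R_def emb_def)
  have omega_diff: "omega (f - g) h = omega f h - omega g h" if "f \<in> D" "g \<in> D" for f g h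
    using omega_add_left[of f "scaleC (- 1) g" h] omega_scaleC_left[of g "- 1" h] that
      adjoint_scaleC(1)[of g "- 1"] by simp
  \<comment> \<open>A nonzero determinant means that \<open>t\<close> and \<open>u\<close> are
    independent modulo \<open>Domain A\<close>. If \<open>t\<close> were a multiple of
    \<open>u\<close> there, \<open>R t t\<close> would be zero, but it is
    \<open>- \<i> * G1 t * cnj (G1 t)\<close>.\<close>
  define \<Delta> where "\<Delta> = omega t gp * omega u gm - omega t gm * omega u gp"
  have "\<Delta> \<noteq> 0"
  proof
    assume \<Delta>: "\<Delta> = 0"
    have "omega u gp \<noteq> 0 \<or> omega u gm \<noteq> 0"
      using Domain_A_if_omega_0 uD u(2) by blast
    then obtain c where "omega t gp = c * omega u gp" "omega t gm = c * omega u gm"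
    proof
      assume "omega u gp \<noteq> 0"
      then show thesis
        using \<Delta> that[of "omega t gp / omega u gp"] by (simp add: \<Delta>_def field_simps)
    next
      assume "omega u gm \<noteq> 0"
      then show thesis
        using \<Delta> that[of "omega t gm / omega u gm"] by (simp add: \<Delta>_def field_simps)
    qed
    then have "t - scaleC c u \<in> Domain A"
      using tD uD by (intro Domain_A_if_omega_0)
        (simp_all add: omega_diff omega_scaleC_left adjoint_diff adjoint_scaleC)
    then have "R ((t - scaleC c u) + scaleC c u) t = 0"
      using tD uD by (subst R_add) (simp_all add: R_A R_scaleC R_u adjoint_scaleC Domain_A_le)
    then show False
      using R_T[OF t(1) tD] t(2) by simp
  qed
  define G0 where "G0 = (\<lambda>f. R f t / cnj (G1 t))"
  have R_eq: "R f g = G0 f * cnj (G1 g)" if f: "f \<in> D" and g: "g \<in> D" for f g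
  proof -
    \<comment> \<open>Cramer's rule: with these coefficients \<open>a\<close> has zero boundary form
      against \<open>gp\<close> and \<open>gm\<close>.\<close>
    define x where "x = (omega f gp * omega u gm - omega f gm * omega u gp) / \<Delta>"
    define y where "y = (omega t gp * omega f gm - omega t gm * omega f gp) / \<Delta>"
    define a where "a = f - (scaleC x t + scaleC y u)"
    have xy: "x * \<Delta> = omega f gp * omega u gm - omega f gm * omega u gp"
      "y * \<Delta> = omega t gp * omega f gm - omega t gm * omega f gp"
      using \<open>\<Delta> \<noteq> 0\<close> by (simp_all add: x_def y_def)
    have s: "scaleC x t + scaleC y u \<in> D"
      using tD uD by (simp add: adjoint_add adjoint_scaleC)
    have om: "omega a h = omega f h - (x * omega t h + y * omega u h)" for h
      using f tD uD s by (simp add: a_def omega_diff omega_add_left omega_scaleC_left adjoint_scaleC)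
    have mult: "(x * omega t h + y * omega u h) * \<Delta> = (x * \<Delta>) * omega t h + (y * \<Delta>) * omega u h" for h
      by (simp add: algebra_simps)
    have "(x * omega t gp + y * omega u gp) * \<Delta> = omega f gp * \<Delta>"
      "(x * omega t gm + y * omega u gm) * \<Delta> = omega f gm * \<Delta>"
      unfolding mult xy by (simp_all add: \<Delta>_def algebra_simps)
    then have a: "a \<in> Domain A"
      using \<open>\<Delta> \<noteq> 0\<close> f s by (intro Domain_A_if_omega_0) (simp_all add: om, simp add: a_def adjoint_diff)
    have "R f h = R (a + (scaleC x t + scaleC y u)) h" for h
      by (simp add: a_def)
    then have "R f h = x * R t h" if "h \<in> D" for h
      using a s tD uD that
      by (simp add: R_add R_scaleC R_A R_u adjoint_scaleC Domain_A_le)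
    then show ?thesis
      using R_T[OF t(1)] g tD t(2) by (simp add: G0_def)
  qed
  have B_eq: "B f g = cinner (As f) g + (G0 f + \<i> * G1 f) * cnj (G1 g)" if "f \<in> D" "g \<in> D" for f g
    using R_eq[OF that] by (simp add: R_def Re_B algebra_simps)
  have triplet: "boundary_triplet A gp gm G0 G1"
  proof
    fix f g assume fg: "f \<in> D" "g \<in> D"
    have "Re_pm B f g = cnj (Re_pm B g f)"
      by (simp add: Re_pm_def adj_pm_def add.commute)
    moreover have "Re_pm B f g = cinner (As f) g + G0 f * cnj (G1 g)"
      using R_eq[OF fg] by (simp add: R_def algebra_simps)
    moreover have "cnj (Re_pm B g f) = cinner f (As g) + cnj (G0 g) * G1 f"
      using R_eq[OF fg(2,1)] by (simp add: R_def diff_eq_eq flip: cinner_commute)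
    ultimately show "omega f g = G1 f * cnj (G0 g) - G0 f * cnj (G1 g)"
      by (simp add: omega_def algebra_simps)
  qed (simp_all add: G0_def R_add R_scaleC G1_add G1_scaleC add_divide_distrib)
  interpret boundary_triplet A gp gm G0 G1 by (rule triplet)
  have "T = restriction \<i>"
  proof (rule set_eqI, rule iffI; clarify)
    fix f f' assume f: "(f, f') \<in> T"
    then have "G0 f * cnj (G1 t) = - \<i> * G1 f * cnj (G1 t)"
      using R_T[of f t] R_eq[of f t] T_As[OF f] tD by auto
    then have "(G0 f + \<i> * G1 f) * cnj (G1 t) = 0"
      by (simp add: algebra_simps)
    then show "(f, f') \<in> restriction \<i>"
      using t(2) T_As[OF f] by (simp add: mem_restriction)
  next
    fix f f' assume "(f, f') \<in> restriction \<i>"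
    then have f: "f \<in> D" "f' = As f" "G0 f = - \<i> * G1 f"
      by (auto simp: mem_restriction add_eq_0_iff2)
    \<comment> \<open>Both \<open>f\<close> and \<open>t\<close> satisfy the same boundary
      condition, so matching \<open>G1\<close> also matches \<open>G0\<close>: \<open>t\<close>
      spans the restriction modulo \<open>Domain A\<close>.\<close>
    define c where "c = G1 f / G1 t"
    have "G0 t = - \<i> * G1 t"
      using R_T[OF t(1) tD] t(2) by (simp add: G0_def)
    then have "f - scaleC c t \<in> Domain A"
      using f t(2) tD by (intro G_kernel) (simp_all add: c_def adjoint_diff adjoint_scaleC G_diff G_linear)
    then have "(f - scaleC c t, As (f - scaleC c t)) \<in> T"
      using A_mem AT by blast
    moreover have "(t, As t) \<in> T"
      using t(1) T_As by blast
    ultimately have "(f - scaleC c t + scaleC c t, As (f - scaleC c t) + scaleC c (As t)) \<in> T"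
      using linear_operatorD(2,3)[OF linT] by blast
    then show "(f, f') \<in> T"
      using f tD by (simp add: adjoint_diff adjoint_scaleC)
  qed
  moreover have "B = state_op (bdry_system A G0 G1)"
    using B_eq B_outside by (auto simp: bdry_system_def bdry_functional_def fun_eq_iff)
  moreover have "K = functional 0"
    using K1_eq K1_outside by (auto simp: bdry_functional_def fun_eq_iff)
  ultimately have "\<Theta> = bdry_system A G0 G1"
    using symm_op by (intro l_system.equality) (simp_all add: T_def B_def K_def)
  then show ?thesis
    using triplet by blast
qed


section \<open>Perturbed impedance functions\<close>

text \<open>At \<open>\<i>\<close> the subtracted term is exactly the real part of
  \<open>1 / (t - \<i>)\<close>, and what remains is \<open>\<i>\<close> times the weight
  \<open>1 / (1 + t^2)\<close>.\<close>

lemma herglotz_integral_ii: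
  assumes "sets \<mu> = sets borel" and "(\<integral>\<^sup>+ t. ennreal (1 / (1 + t\<^sup>2)) \<partial>\<mu>) = ennreal c" and "c \<ge> 0"
  shows "herglotz_integral \<mu> \<i> = \<i> * c"
proof -
  have meas: "(\<lambda>t::real. 1 / (1 + t\<^sup>2)) \<in> borel_measurable \<mu>"
    unfolding measurable_cong_sets[OF assms(1) refl] by measurable
  have "(LINT t|\<mu>. 1 / (1 + t\<^sup>2)) = c"
    using assms(2,3) by (subst integral_eq_nn_integral[OF meas]) auto
  moreover have "1 / (complex_of_real t - \<i>) - complex_of_real (t / (1 + t\<^sup>2))
      = \<i> * complex_of_real (1 / (1 + t\<^sup>2))" for t
  proof -
    have "complex_of_real t - \<i> \<noteq> 0" "complex_of_real t + \<i> \<noteq> 0"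
      by (auto simp: complex_eq_iff)
    moreover have "(complex_of_real t - \<i>) * (complex_of_real t + \<i>) = complex_of_real (1 + t\<^sup>2)"
      by (simp add: algebra_simps power2_eq_square)
    ultimately have "1 / (complex_of_real t - \<i>) = (complex_of_real t + \<i>) / complex_of_real (1 + t\<^sup>2)"
      by (metis mult_divide_mult_cancel_right mult_1)
    then show ?thesis
      by (simp add: add_divide_distrib)
  qed
  ultimately show ?thesis
    by (simp add: herglotz_integral_def del: of_real_divide)
qed

lemma class_M_ii: "V \<in> class_M \<Longrightarrow> V \<i> = \<i>"
  using herglotz_integral_ii[where c = 1] by (auto simp: class_M_def infinite_borel_measure_def)

text \<open>The constant \<open>c\<close> is the integral of \<open>1 / (1 + t^2)\<close>; a
  strictly positive function on a space of infinite measure has nonzero integral.\<close>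

lemma class_N_ii:
  assumes "V \<in> class_N Q"
  shows "\<exists>c>0. V \<i> = complex_of_real Q + \<i> * complex_of_real c"
proof -
  obtain \<mu> where \<mu>: "sets \<mu> = sets borel" "emeasure \<mu> UNIV = \<infinity>"
    and fin: "(\<integral>\<^sup>+ t. ennreal (1 / (1 + t\<^sup>2)) \<partial>\<mu>) < \<infinity>"
    and V: "V \<i> = complex_of_real Q + herglotz_integral \<mu> \<i>"
    using assms by (auto simp: class_N_def infinite_borel_measure_def)
  have meas: "(\<lambda>t::real. ennreal (1 / (1 + t\<^sup>2))) \<in> borel_measurable \<mu>"
    unfolding measurable_cong_sets[OF \<mu>(1) refl] by measurable
  obtain c where c: "c \<ge> 0" "(\<integral>\<^sup>+ t. ennreal (1 / (1 + t\<^sup>2)) \<partial>\<mu>) = ennreal c"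
    using fin by (cases "\<integral>\<^sup>+ t. ennreal (1 / (1 + t\<^sup>2)) \<partial>\<mu>") auto
  have "c \<noteq> 0"
  proof
    assume "c = 0"
    then have "emeasure \<mu> {t \<in> space \<mu>. ennreal (1 / (1 + t\<^sup>2)) \<noteq> 0} = 0"
      using c(2) nn_integral_0_iff[OF meas] by simp
    moreover have "ennreal (1 / (1 + t\<^sup>2)) \<noteq> 0" for t :: real
      by (simp add: ennreal_eq_0_iff not_le add_pos_nonneg)
    ultimately have "emeasure \<mu> (space \<mu>) = 0" by simp
    then show False
      using \<mu> sets_eq_imp_space_eq[OF \<mu>(1)] by simp
  qed
  then show ?thesis
    using V herglotz_integral_ii[OF \<mu>(1) c(2,1)] c(1) by auto
qed

text \<open>Multiplying the channel by a unimodular constant changes neither the state operator nor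
  the impedance, so channels are compared only up to such a constant.\<close>

theorem theorem41:
  fixes Q a :: real
    and V V\<^sub>0 :: "complex \<Rightarrow> complex"
    and \<Theta>\<^sub>0 :: "'h::complex_hilbert l_system"
    and g :: "complex \<Rightarrow> 'h"
  assumes "Q \<noteq> 0"
    and "V\<^sub>0 \<in> class_M"
    and "V \<in> class_N Q"
    and "\<And>z. Im z \<noteq> 0 \<Longrightarrow> V z = complex_of_real Q + complex_of_real a * V\<^sub>0 z"
    and "minimal_L_system \<Theta>\<^sub>0"
    and "realizes \<Theta>\<^sub>0 V\<^sub>0"
    and "\<And>z. Im z \<noteq> 0 \<Longrightarrow> g z \<in> deficiency_space (symm_op \<Theta>\<^sub>0) z \<and> g z \<noteq> 0"
    and "norm (g \<i>) = 1" and "norm (g (- \<i>)) = 1"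
    and "\<exists>z. Im z > 0 \<and> livsic_function g z \<noteq> 0"
  shows "\<exists>\<Theta>. is_L_system \<Theta> \<and> symm_op \<Theta> = symm_op \<Theta>\<^sub>0 \<and> realizes \<Theta> V
    \<and> (\<forall>\<Theta>'::'h l_system. is_L_system \<Theta>' \<and> symm_op \<Theta>' = symm_op \<Theta>\<^sub>0 \<and> realizes \<Theta>' V \<longrightarrow>
         main_op \<Theta>' = main_op \<Theta> \<and> state_op \<Theta>' = state_op \<Theta>
         \<and> (\<exists>u. cmod u = 1 \<and> channel_op \<Theta>' = (\<lambda>c. channel_op \<Theta> (u * c))))"
proof -
  define A where "A = symm_op \<Theta>\<^sub>0"
  have \<Theta>\<^sub>0: "is_L_system \<Theta>\<^sub>0"
    using assms(5) by (simp add: minimal_L_system_def)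
  have g: "g z \<in> deficiency_space A z" "g z \<noteq> 0" if "Im z \<noteq> 0" for z
    using assms(7)[OF that] by (simp_all add: A_def)
  interpret symmetric_op_11 A "g \<i>" "g (- \<i>)"
    using \<Theta>\<^sub>0 g[of \<i>] g[of "- \<i>"]
    by unfold_locales (auto simp: is_L_system_def Let_def A_def)
  obtain G0 G1 where G: "boundary_triplet A (g \<i>) (g (- \<i>)) G0 G1"
    and \<Theta>\<^sub>0_eq: "\<Theta>\<^sub>0 = bdry_system A G0 G1"
    using L_system_is_bdry_system[OF \<Theta>\<^sub>0 A_def[symmetric]] by blast
  interpret G: boundary_triplet A "g \<i>" "g (- \<i>)" G0 G1 by (rule G)
  have V\<^sub>0: "V\<^sub>0 z = G1 (g z) / G0 (g z)" if "Im z \<noteq> 0" for z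
    using assms(6) G.impedance_Theta[OF g[OF that] that] that by (simp add: realizes_def \<Theta>\<^sub>0_eq)
  have V\<^sub>0_ii: "V\<^sub>0 \<i> = \<i>"
    using assms(2) by (rule class_M_ii)
  obtain c where "c > 0" "V \<i> = complex_of_real Q + \<i> * complex_of_real c"
    using class_N_ii[OF assms(3)] by blast
  \<comment> \<open>Comparing imaginary parts at \<open>\<i>\<close>, where \<open>V\<^sub>0\<close>
    equals \<open>\<i>\<close>, gives \<open>a = c\<close>.\<close>
  then have "a > 0"
    using assms(4)[of \<i>] V\<^sub>0_ii by (simp add: complex_eq_iff)
  define r where "r = sqrt a"
  have r: "r \<noteq> 0" "r * r = a"
    using \<open>a > 0\<close> by (simp_all add: r_def)
  define H0 where "H0 = (\<lambda>f. G0 f / r)"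
  define H1 where "H1 = (\<lambda>f. r * G1 f + Q * (G0 f / r))"
  interpret H: boundary_triplet A "g \<i>" "g (- \<i>)" H0 H1
    unfolding H0_def H1_def using r(1) by (rule G.affine_triplet)
  have V: "V z = H1 (g z) / H0 (g z)" if "Im z \<noteq> 0" for z
  proof -
    have "H1 (g z) / H0 (g z) = Q + complex_of_real (r * r) * (G1 (g z) / G0 (g z))"
      using G.G0_deficiency_neq_0[OF g[OF that] that] r(1)
      by (simp add: H0_def H1_def field_simps)
    then show ?thesis
      using assms(4) V\<^sub>0 that r(2) by simp
  qed
  obtain z where z: "Im z > 0" "V\<^sub>0 z \<noteq> \<i>"
  proof -
    obtain z where z: "Im z > 0" "livsic_function g z \<noteq> 0"
      using assms(10) by blast
    \<comment> \<open>For deficiency vectors at \<open>z\<close> and \<open>- \<i>\<close> the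
      boundary form is \<open>z - \<i>\<close> times their inner product, the numerator of the
      Livsic function.\<close>
    then have "omega (g z) (g (- \<i>)) \<noteq> 0"
      using omega_deficiency[OF g(1) g(1), of z "- \<i>"] by (auto simp: livsic_function_def)
    \<comment> \<open>If \<open>V\<^sub>0 z = \<i>\<close>, the boundary values of
      \<open>g z\<close> are proportional to those of \<open>g \<i>\<close>, whose boundary form
      with \<open>g (- \<i>)\<close> is zero; the form for \<open>g z\<close> would then vanish as
      well.\<close>
    moreover have "G1 (g z) = \<i> * G0 (g z)" if "V\<^sub>0 z = \<i>"
      using V\<^sub>0[of z] that z(1) G.G0_deficiency_neq_0[OF g, of z] by (simp add: field_simps)
    moreover have "G1 (g \<i>) = \<i> * G0 (g \<i>)" "G0 (g \<i>) \<noteq> 0"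
      using V\<^sub>0[of \<i>] V\<^sub>0_ii G.G0_deficiency_neq_0[OF g, of \<i>] by (simp_all add: field_simps)
    moreover have "G1 (g \<i>) * cnj (G0 (g (- \<i>))) = G0 (g \<i>) * cnj (G1 (g (- \<i>)))"
      using omega_gp_gm gp_D gm_D by (simp add: G.green)
    ultimately have "V\<^sub>0 z \<noteq> \<i>"
      using g(1)[of z] z(1) gm_D by (auto simp: G.green deficiency_iff)
    then show thesis using that z(1) by blast
  qed
  have "V z = impedance H.Theta z" if "Im z \<noteq> 0" for z
    using V[OF that] H.impedance_Theta[OF g[OF that] that] by simp
  then have "realizes H.Theta V"
    by (simp add: realizes_def)
  moreover have "main_op \<Theta>' = main_op H.Theta \<and> state_op \<Theta>' = state_op H.Theta
      \<and> (\<exists>u. cmod u = 1 \<and> channel_op \<Theta>' = (\<lambda>c. channel_op H.Theta (u * c)))"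
    if \<Theta>': "is_L_system \<Theta>'" "symm_op \<Theta>' = A" "realizes \<Theta>' V" for \<Theta>' :: "'h l_system"
  proof -
    obtain J0 J1 where J: "boundary_triplet A (g \<i>) (g (- \<i>)) J0 J1"
      and \<Theta>'_eq: "\<Theta>' = bdry_system A J0 J1"
      using L_system_is_bdry_system[OF \<Theta>'(1,2)] by blast
    interpret J: boundary_triplet A "g \<i>" "g (- \<i>)" J0 J1 by (rule J)
    have VJ: "J1 (g w) / J0 (g w) = H1 (g w) / H0 (g w)" if "Im w \<noteq> 0" for w
      using \<Theta>'(3) V[OF that] J.impedance_Theta[OF g[OF that] that] that
      by (simp add: realizes_def \<Theta>'_eq)
    \<comment> \<open>The uniqueness of triplets needs two points with different Weyl quotients; as
      \<open>a\<close> is nonzero, \<open>V\<close> separates \<open>z\<close> from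
      \<open>\<i>\<close> because \<open>V\<^sub>0\<close> does.\<close>
    have "V z \<noteq> V \<i>"
      using assms(4)[of z] assms(4)[of \<i>] z V\<^sub>0_ii \<open>a > 0\<close> by simp
    then have "H1 (g z) / H0 (g z) \<noteq> H1 (g \<i>) / H0 (g \<i>)"
      using V[of z] V[of \<i>] z(1) by simp
    then have "\<exists>u. cmod u = 1 \<and> (\<forall>k\<in>D. J0 k = u * H0 k \<and> J1 k = u * H1 k)"
      using z(1) by (intro H.triplet_unique[OF J, of "g z" z "g \<i>" \<i>] g VJ) simp_all
    then obtain u where u: "cmod u = 1" and "\<forall>k\<in>D. J0 k = u * H0 k \<and> J1 k = u * H1 k"
      by blast
    then have J_eq: "J0 k = u * H0 k \<and> J1 k = u * H1 k" if "k \<in> D" for k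
      using that by blast
    \<comment> \<open>The channel involves the conjugate of the second boundary functional, so its
      unimodular constant is \<open>cnj u\<close>.\<close>
    have "cmod (cnj u) = 1"
      using u by simp
    moreover have "main_op J.Theta = main_op H.Theta" "state_op J.Theta = state_op H.Theta"
      "channel_op J.Theta = (\<lambda>c. channel_op H.Theta (cnj u * c))"
      by (rule bdry_system_unimodular[OF u], erule J_eq)+
    ultimately show ?thesis
      unfolding \<Theta>'_eq by blast
  qed
  ultimately show ?thesis
    unfolding A_def[symmetric] using H.is_L_system_Theta H.Theta_simps(1) by blast
qed

end
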